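(* Let $V$ be an $n$-dimensional real vector space with a Euclidean inner product, and let $\mathcal{A}$ be a complex $m$th order covariant tensor on $V$. Then $\mathrm{Res}_{\mathbf{x}}(\mathcal{A}\mathbf{x}^{m-1})$ is an orthonormal invariant of $\mathcal{A}$. Furthermore, all the coefficients of the E-characteristic polynomial $\psi_{\mathcal{A}}(\lambda)$ are orthonormal invariants of $\mathcal{A}$.
   Context: An $m$th order covariant tensor on $V$ is a multilinear function on $V^m$, here allowed to take complex values. Its hypermatrix with respect to an orthonormal frame $\{e_1,\dots,e_n\}$ is $A=(a_{i_1\cdots i_m})$ with $a_{i_1\cdots i_m}=\mathcal{A}(e_{i_1},\dots,e_{i_m})$. If $\tilde e_i=\sum_j C_i^j e_j$ with $(C_i^j)\in O(n)$, the hypermatrix in the frame $\{\tilde e_i\}$ is $\tilde a_{i_1\cdots i_m}=\sum C_{i_1}^{j_1}\cdots C_{i_m}^{j_m}a_{j_1\cdots j_m}$. A quantity is an orthonormal invariant if it does not change under a change of orthonormal frame. For a hypermatrix $A$ and $x=(x_1,\dots,x_n)^T$, $Ax^{m-1}$ is the vector with components $(Ax^{m-1})_i=\sum_{i_2,\dots,i_m=1}^n a_{ii_2\cdots i_m}x_{i_2}\cdots x_{i_m}$. $\mathrm{Res}$ denotes the classical multipolynomial resultant of $N$ homogeneous polynomials (of prescribed degrees $d_1,\dots,d_N$) in $N$ variables, normalized by $\mathrm{Res}(x_1^{d_1},\dots,x_N^{d_N})=1$. $\mathrm{Res}_x(Ax^{m-1})$ is the resultant of the $n$ components of $Ax^{m-1}$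 in the variables $x_1,\dots,x_n$ (degrees $m-1$). The E-characteristic polynomial: for $m$ even, $\psi_A(\lambda)=\mathrm{Res}_x\big(Ax^{m-1}-\lambda(x^Tx)^{(m-2)/2}x\big)$ ($n$ forms of degree $m-1$ in $x_1,\dots,x_n$). For $m$ odd, $\psi_A(\lambda)$ is the resultant in the $n+1$ variables $(x_1,\dots,x_n,x_0)$ of the $n$ components of $Ax^{m-1}-\lambda x_0^{m-2}x$ (degree $m-1$) together with $x^Tx-x_0^2$ (degree $2$). Here $x^Tx=\sum_i x_i^2$. We write $\mathrm{Res}_{\mathbf{x}}(\mathcal{A}\mathbf{x}^{m-1})$ and $\psi_{\mathcal{A}}(\lambda)$ for $\mathrm{Res}_x(Ax^{m-1})$ and $\psi_A(\lambda)$, where $A$ is the hypermatrix of $\mathcal{A}$ in a fixed orthonormal frame; the assertion is that the first quantity, and each coefficient of the second, is the same whichever orthonormal frame is used.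
   Formalization: The invariance of Res is claimed only for m even or n ≥ 2: for n = 1 and m odd, Res is the single entry a, which becomes −a under e → −e. Also m ≥ 2 is assumed, since for m = 1 the forms have degree 0 and x_0^{m−2} is undefined. *)

theory Defs
  imports
    "HOL-Analysis.Analysis"
    "HOL-Library.Poly_Mapping"
    "HOL-Computational_Algebra.Computational_Algebra"
begin

section \<open>Multivariate polynomials\<close>

type_synonym 'x monom = "'x \<Rightarrow>\<^sub>0 nat"
type_synonym ('x, 'c) mpoly = "'x monom \<Rightarrow>\<^sub>0 'c"

definition Const :: "'c::zero \<Rightarrow> ('x, 'c) mpoly" where
  "Const c = Poly_Mapping.single 0 c"

definition Var :: "'x \<Rightarrow> ('x, 'c::zero_neq_one) mpoly" where
  "Var i = Poly_Mapping.single (Poly_Mapping.single i 1) 1"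

text \<open>The value of a polynomial at the point \<open>z\<close>, its coefficients being mapped
  into the target ring by \<open>h\<close>.\<close>

definition eval_mpoly :: "('c::zero \<Rightarrow> 'r) \<Rightarrow> ('x \<Rightarrow> 'r) \<Rightarrow> ('x, 'c) mpoly \<Rightarrow> 'r::comm_semiring_1" where
  "eval_mpoly h z p =
     (\<Sum>\<alpha>\<in>Poly_Mapping.keys p. h (Poly_Mapping.lookup p \<alpha>) *
        (\<Prod>i\<in>Poly_Mapping.keys \<alpha>. z i ^ Poly_Mapping.lookup \<alpha> i))"

definition monom_degree :: "'x::finite monom \<Rightarrow> nat" where
  "monom_degree \<alpha> = (\<Sum>i\<in>UNIV. Poly_Mapping.lookup \<alpha> i)"

definition homogeneous :: "nat \<Rightarrow> ('x::finite, 'c::zero) mpoly \<Rightarrow> bool" where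
  "homogeneous d p \<longleftrightarrow> (\<forall>\<alpha>\<in>Poly_Mapping.keys p. monom_degree \<alpha> = d)"


section \<open>The multipolynomial resultant\<close>

text \<open>The variables of \<open>N\<close> forms are indexed by a type \<open>'x\<close> with \<open>N\<close> elements, and so are the
  forms themselves; the form \<open>i\<close> has degree \<open>d i\<close>. The resultant is an integer polynomial in
  indeterminates \<open>u\<^bsub>i,\<alpha>\<^esub>\<close>, one for each form \<open>i\<close> and each monomial \<open>\<alpha>\<close> of degree \<open>d i\<close>.\<close>

type_synonym 'x coeff_var = "'x \<times> 'x monom"

definition coeffs_of :: "('x \<Rightarrow> ('x, 'c::zero) mpoly) \<Rightarrow> 'x coeff_var \<Rightarrow> 'c" where
  "coeffs_of F = (\<lambda>(i, \<alpha>). Poly_Mapping.lookup (F i) \<alpha>)"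

text \<open>The standard characterization, for positive degrees: \<open>R\<close> vanishes exactly at those systems of
  complex forms that have a nontrivial common zero, \<open>R\<close> is irreducible even over the complex
  numbers, and \<open>R\<close> takes the value 1 at the system of the \<open>x\<^sub>i ^ d i\<close>.\<close>

definition is_resultant_poly ::
    "('x::finite \<Rightarrow> nat) \<Rightarrow> ('x coeff_var, int) mpoly \<Rightarrow> bool" where
  "is_resultant_poly d R \<longleftrightarrow>
     (\<forall>\<mu>\<in>Poly_Mapping.keys R. \<forall>(i, \<alpha>)\<in>Poly_Mapping.keys \<mu>. monom_degree \<alpha> = d i) \<and>
     (\<forall>F :: 'x \<Rightarrow> ('x, complex) mpoly. (\<forall>i. homogeneous (d i) (F i)) \<longrightarrow>
        (eval_mpoly of_int (coeffs_of F) R = 0 \<longleftrightarrow>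
         (\<exists>z :: 'x \<Rightarrow> complex. (\<exists>i. z i \<noteq> 0) \<and> (\<forall>i. eval_mpoly id z (F i) = 0)))) \<and>
     irreducible (Poly_Mapping.map of_int R :: ('x coeff_var, complex) mpoly) \<and>
     eval_mpoly id (coeffs_of (\<lambda>i. Var i ^ d i)) R = 1"

text \<open>For positive degrees exactly one polynomial satisfies the predicate above. Since it has integer
  coefficients, it can be evaluated at forms over any commutative ring.\<close>

definition resultant ::
    "('x::finite \<Rightarrow> nat) \<Rightarrow> ('x \<Rightarrow> ('x, 'c) mpoly) \<Rightarrow> 'c::comm_ring_1" where
  "resultant d F =
     (THE v. \<exists>R. is_resultant_poly d R \<and> v = eval_mpoly of_int (coeffs_of F) R)"


section \<open>Tensors, frames and hypermatrices\<close>

text \<open>An element of \<open>V\<^sup>m\<close> is a list of length \<open>m\<close>; values at lists of other lengths are irrelevant.\<close>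

definition complex_tensor :: "nat \<Rightarrow> ('v::real_vector list \<Rightarrow> complex) \<Rightarrow> bool" where
  "complex_tensor m T \<longleftrightarrow>
     (\<forall>vs. length vs = m \<longrightarrow> (\<forall>i<m. linear (\<lambda>v. T (vs[i := v]))))"

definition orthonormal_frame :: "('n::finite \<Rightarrow> 'v::euclidean_space) \<Rightarrow> bool" where
  "orthonormal_frame e \<longleftrightarrow>
     (\<forall>i j. e i \<bullet> e j = (if i = j then 1 else 0)) \<and> span (range e) = UNIV"

definition hypermatrix :: "('v list \<Rightarrow> complex) \<Rightarrow> ('n \<Rightarrow> 'v) \<Rightarrow> 'n list \<Rightarrow> complex" where
  "hypermatrix T e is = T (map e is)"

text \<open>A quantity computed from hypermatrices is an orthonormal invariant of \<open>T\<close> if its value does not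
  depend on the orthonormal frame in which the hypermatrix of \<open>T\<close> is taken.\<close>

definition orthonormal_invariant ::
    "(('n::finite list \<Rightarrow> complex) \<Rightarrow> 'b) \<Rightarrow> ('v::euclidean_space list \<Rightarrow> complex) \<Rightarrow> bool" where
  "orthonormal_invariant Q T \<longleftrightarrow>
     (\<forall>e e' :: 'n \<Rightarrow> 'v. orthonormal_frame e \<longrightarrow> orthonormal_frame e' \<longrightarrow>
        Q (hypermatrix T e) = Q (hypermatrix T e'))"

text \<open>The component \<open>i\<close> of \<open>A x\<^sup>m\<^sup>-\<^sup>1\<close>. The entries of \<open>x\<close> may lie in any commutative ring, such as a
  polynomial ring, into which \<open>c\<close> maps the entries of \<open>A\<close>.\<close>

definition hm_apply ::
    "nat \<Rightarrow> (complex \<Rightarrow> 'r) \<Rightarrow> ('n::finite list \<Rightarrow> complex) \<Rightarrow> ('n \<Rightarrow> 'r) \<Rightarrow> 'n \<Rightarrow> 'r::comm_semiring_1" where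
  "hm_apply m c A x i =
     (\<Sum>is | length is = m - 1. c (A (i # is)) * prod_list (map x is))"

text \<open>In dimension 1 this is the single entry of \<open>A\<close>, which changes sign under \<open>e \<mapsto> - e\<close> when
  \<open>m\<close> is odd; it is an orthonormal invariant in all other cases with \<open>m \<ge> 2\<close>.\<close>

definition hm_resultant :: "nat \<Rightarrow> ('n::finite list \<Rightarrow> complex) \<Rightarrow> complex" where
  "hm_resultant m A = resultant (\<lambda>_. m - 1) (hm_apply m Const A Var)"


section \<open>The E-characteristic polynomial\<close>

text \<open>It is the resultant of forms whose coefficients are polynomials in \<open>\<lambda>\<close>, so that it
  is itself a polynomial in \<open>\<lambda>\<close>. In the odd case the variables are indexed by \<open>'n option\<close>:
  \<open>Some i\<close> stands for \<open>x\<^sub>i\<close> and \<open>None\<close> for the additional variable \<open>x\<^sub>0\<close>, and the quadratic form is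
  the form with index \<open>None\<close>.\<close>

definition lam :: "('x, complex poly) mpoly" where
  "lam = Const [:0, 1:]"

definition E_forms_even ::
    "nat \<Rightarrow> ('n::finite list \<Rightarrow> complex) \<Rightarrow> 'n \<Rightarrow> ('n, complex poly) mpoly" where
  "E_forms_even m A i =
     hm_apply m (\<lambda>a. Const [:a:]) A Var i
       - lam * (\<Sum>j\<in>UNIV. Var j ^ 2) ^ ((m - 2) div 2) * Var i"

definition E_forms_odd ::
    "nat \<Rightarrow> ('n::finite list \<Rightarrow> complex) \<Rightarrow> 'n option \<Rightarrow> ('n option, complex poly) mpoly" where
  "E_forms_odd m A k =
     (case k of
        Some i \<Rightarrow> hm_apply m (\<lambda>a. Const [:a:]) A (\<lambda>j. Var (Some j)) i
                    - lam * Var None ^ (m - 2) * Var (Some i)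
      | None \<Rightarrow> (\<Sum>j\<in>UNIV. Var (Some j) ^ 2) - Var None ^ 2)"

definition E_char_poly :: "nat \<Rightarrow> ('n::finite list \<Rightarrow> complex) \<Rightarrow> complex poly" where
  "E_char_poly m A =
     (if even m then resultant (\<lambda>_. m - 1) (E_forms_even m A)
      else resultant (\<lambda>k. case k of Some _ \<Rightarrow> m - 1 | None \<Rightarrow> 2) (E_forms_odd m A))"

end

theory Submission
  imports Defs
begin

text \<open>Two frames are connected by a chain of reflections, so it suffices to compare a frame with
  its image under the reflection in a unit vector. This changes the system of forms from \<open>F\<close> to
  \<open>s \<circ> F \<circ> s\<close>, where \<open>s\<close> is a reflection in the coordinate space.

  Let \<open>R\<close> be any polynomial that vanishes exactly at the systems with a nontrivial common zero.
  The reflection \<open>s\<close> is the value at \<open>c = -1\<close> of the family \<open>s\<^sub>c\<close> that multiplies the normal vector by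
  \<open>c \<noteq> 0\<close>. For two systems \<open>F\<close>, \<open>G\<close> without common zero, the polynomial
  \<open>t \<mapsto> R(s\<^sub>c \<circ> (F + t(G - F)) \<circ> s\<^sub>c)\<close> has the same roots for all \<open>c\<close>; hence the ratio of its values at
  1 and 0 takes only finitely many values, and being continuous on the connected set \<open>c \<noteq> 0\<close> it is
  constant. Thus \<open>R(s \<circ> F \<circ> s) = \<chi> R(F)\<close> with \<open>\<chi>\<close> independent of \<open>F\<close>, and \<open>\<chi> = 1\<close> because there is a
  system without common zero that is fixed by \<open>s\<close>. Neither existence nor uniqueness
  of the resultant polynomial is needed: the set of candidate values is the same in both frames.\<close>

section \<open>Homomorphisms of coefficient rings\<close>

text \<open>Unital ring homomorphisms between arbitrary commutative rings. One set of rules then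
  serves \<open>Const\<close>, the embedding of constants into polynomials in \<lambda>, evaluation
  of these at a number, and \<open>eval_mpoly\<close> itself.\<close>

locale coeff_hom =
  fixes h :: "'a::comm_ring_1 \<Rightarrow> 'b::comm_ring_1"
  assumes add: "h (a + b) = h a + h b"
    and mult: "h (a * b) = h a * h b"
    and one: "h 1 = 1"
begin

lemma zero: "h 0 = 0"
  using add[of 0 0] by simp

lemma minus: "h (- a) = - h a"
  using add[of a "- a"] zero by (simp add: add_eq_0_iff2)

lemma diff: "h (a - b) = h a - h b"
  using add[of a "- b"] by (simp add: minus)

lemma sum: "h (sum f A) = (\<Sum>x\<in>A. h (f x))"
  by (induction A rule: infinite_finite_induct) (simp_all add: zero add)

lemma prod: "h (prod f A) = (\<Prod>x\<in>A. h (f x))"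
  by (induction A rule: infinite_finite_induct) (simp_all add: one mult)

lemma prod_list: "h (prod_list xs) = prod_list (map h xs)"
  by (induction xs) (simp_all add: one mult)

lemma power: "h (a ^ k) = h a ^ k"
  by (induction k) (simp_all add: one mult)

lemma of_int: "h (of_int k) = of_int k"
proof -
  have nat: "h (of_nat n) = of_nat n" for n
    by (induction n) (simp_all add: zero one add)
  show ?thesis
    by (cases k rule: int_cases2) (simp_all add: nat minus)
qed

lemmas simps = zero one add minus diff mult sum prod prod_list power

end

lemma coeff_hom_compose: "coeff_hom g \<Longrightarrow> coeff_hom h \<Longrightarrow> coeff_hom (\<lambda>x. g (h x))"
  by (simp add: coeff_hom_def)

lemma coeff_hom_id: "coeff_hom id"
  by (simp add: coeff_hom_def)

lemma coeff_hom_Const: "coeff_hom Const"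
  by (simp add: coeff_hom_def Const_def single_add mult_single)

lemma coeff_hom_poly: "coeff_hom (\<lambda>p. poly p z)"
  by (simp add: coeff_hom_def)

lemma coeff_hom_pConst: "coeff_hom (\<lambda>a. [:a:])"
  by (simp add: coeff_hom_def one_pCons)

section \<open>Evaluation as a ring homomorphism\<close>

definition eval_monom :: "('x \<Rightarrow> 'r) \<Rightarrow> 'x monom \<Rightarrow> 'r::comm_semiring_1" where
  "eval_monom z \<alpha> = (\<Prod>i\<in>Poly_Mapping.keys \<alpha>. z i ^ Poly_Mapping.lookup \<alpha> i)"

lemma eval_monom_superset:
  assumes "finite A" "Poly_Mapping.keys \<alpha> \<subseteq> A"
  shows "eval_monom z \<alpha> = (\<Prod>i\<in>A. z i ^ Poly_Mapping.lookup \<alpha> i)"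
  unfolding eval_monom_def
  by (rule prod.mono_neutral_left) (use assms in \<open>auto simp: in_keys_iff\<close>)

lemma eval_monom_add: "eval_monom z (\<alpha> + \<beta>) = eval_monom z \<alpha> * eval_monom z \<beta>"
proof -
  let ?A = "Poly_Mapping.keys \<alpha> \<union> Poly_Mapping.keys \<beta>"
  show ?thesis
    using keys_add[of \<alpha> \<beta>]
    by (simp add: eval_monom_superset[of ?A] lookup_add power_add prod.distrib)
qed

lemma eval_mpoly_monom:
  "eval_mpoly h z p = (\<Sum>\<alpha>\<in>Poly_Mapping.keys p. h (Poly_Mapping.lookup p \<alpha>) * eval_monom z \<alpha>)"
  by (simp add: eval_mpoly_def eval_monom_def)

lemma mpoly_sum_single:
  "p = (\<Sum>\<alpha>\<in>Poly_Mapping.keys p. Poly_Mapping.single \<alpha> (Poly_Mapping.lookup p \<alpha>))"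
proof (rule poly_mapping_eqI)
  fix \<beta>
  show "Poly_Mapping.lookup p \<beta> =
      Poly_Mapping.lookup (\<Sum>\<alpha>\<in>Poly_Mapping.keys p. Poly_Mapping.single \<alpha> (Poly_Mapping.lookup p \<alpha>)) \<beta>"
    by (simp add: lookup_sum lookup_single when_def in_keys_iff)
qed

lemma eval_mpoly_single:
  assumes "coeff_hom h"
  shows "eval_mpoly h z (Poly_Mapping.single \<alpha> a) = h a * eval_monom z \<alpha>"
  by (simp add: eval_mpoly_monom coeff_hom.zero[OF assms])

lemma eval_mpoly_add:
  assumes "coeff_hom h"
  shows "eval_mpoly h z (p + q) = eval_mpoly h z p + eval_mpoly h z q"
  unfolding eval_mpoly_monom
  by (rule setsum_keys_plus_distrib) (simp_all add: coeff_hom.simps[OF assms] distrib_right)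

lemma eval_mpoly_sum:
  assumes "coeff_hom h"
  shows "eval_mpoly h z (sum f A) = (\<Sum>x\<in>A. eval_mpoly h z (f x))"
proof (induction A rule: infinite_finite_induct)
qed (simp_all add: eval_mpoly_add[OF assms], simp_all add: eval_mpoly_monom)

text \<open>Both factors are sums of single terms, and for single terms the claim reduces to
  \<open>eval_monom_add\<close>.\<close>

lemma eval_mpoly_mult:
  assumes "coeff_hom h"
  shows "eval_mpoly h z (p * q) = eval_mpoly h z p * eval_mpoly h z q"
proof -
  let ?s = "\<lambda>p \<alpha>. Poly_Mapping.single \<alpha> (Poly_Mapping.lookup p \<alpha>)"
  have "p * q = (\<Sum>\<alpha>\<in>Poly_Mapping.keys p. \<Sum>\<beta>\<in>Poly_Mapping.keys q. ?s p \<alpha> * ?s q \<beta>)"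
    by (subst mpoly_sum_single[of p], subst mpoly_sum_single[of q]) (simp add: sum_product)
  also have "eval_mpoly h z \<dots> = eval_mpoly h z p * eval_mpoly h z q"
    by (simp add: eval_mpoly_sum[OF assms] mult_single eval_mpoly_single[OF assms] eval_monom_add
        coeff_hom.mult[OF assms])
      (simp add: eval_mpoly_monom sum_product mult_ac)
  finally show ?thesis .
qed

lemma coeff_hom_eval_mpoly:
  assumes "coeff_hom h"
  shows "coeff_hom (eval_mpoly h z)"
proof
  have "eval_mpoly h z (Poly_Mapping.single 0 1) = 1"
    by (simp only: eval_mpoly_single[OF assms])
      (simp add: coeff_hom.one[OF assms] eval_monom_def)
  then show "eval_mpoly h z 1 = 1"
    by simp
qed (simp_all add: eval_mpoly_add[OF assms] eval_mpoly_mult[OF assms])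

lemma eval_mpoly_Const:
  assumes "coeff_hom h"
  shows "eval_mpoly h z (Const a) = h a"
  by (simp add: Const_def eval_mpoly_single[OF assms] eval_monom_def)

lemma eval_mpoly_Var:
  assumes "coeff_hom h"
  shows "eval_mpoly h z (Var i) = z i"
  by (simp add: Var_def eval_mpoly_single[OF assms] eval_monom_def coeff_hom.one[OF assms])

text \<open>With \<open>g\<close> itself an evaluation or a substitution, this is the composition
  law for substitutions.\<close>

lemma hom_eval_mpoly:
  assumes "coeff_hom g"
  shows "g (eval_mpoly h z p) = eval_mpoly (\<lambda>a. g (h a)) (\<lambda>i. g (z i)) p"
  by (simp add: eval_mpoly_def coeff_hom.simps[OF assms])

lemma eval_mpoly_Const_Var:
  fixes p :: "('x, 'c::comm_ring_1) mpoly"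
  shows "eval_mpoly Const Var p = p"
proof -
  have var: "Var i ^ k = Poly_Mapping.single (Poly_Mapping.single i k) (1::'c::comm_ring_1)"
    for i :: 'x and k
    by (induction k) (simp_all add: Var_def mult_single flip: single_add)
  have "(\<Prod>i\<in>A. Poly_Mapping.single (f i) (1::'c::comm_ring_1)) = Poly_Mapping.single (sum f A) 1"
    for A and f :: "'x \<Rightarrow> 'x monom"
    by (induction A rule: infinite_finite_induct) (simp_all add: mult_single)
  then have "eval_monom Var \<alpha> = Poly_Mapping.single \<alpha> (1::'c::comm_ring_1)" for \<alpha> :: "'x monom"
    unfolding eval_monom_def var using mpoly_sum_single[of \<alpha>] by metis
  then have "eval_mpoly Const Var p =
      (\<Sum>\<alpha>\<in>Poly_Mapping.keys p. Poly_Mapping.single \<alpha> (Poly_Mapping.lookup p \<alpha>))"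
    by (simp add: eval_mpoly_monom Const_def mult_single)
  then show ?thesis
    using mpoly_sum_single by metis
qed

text \<open>Expressed as a substitution, so that \<open>coeff_hom_eval_mpoly\<close> makes it a ring
  homomorphism at once; \<open>lookup_map_coeffs\<close> recovers the coefficientwise
  description.\<close>

definition map_coeffs :: "('a::comm_ring_1 \<Rightarrow> 'b::comm_ring_1) \<Rightarrow> ('x, 'a) mpoly \<Rightarrow> ('x, 'b) mpoly" where
  "map_coeffs h = eval_mpoly (\<lambda>a. Const (h a)) Var"

lemma coeff_hom_map_coeffs: "coeff_hom h \<Longrightarrow> coeff_hom (map_coeffs h)"
  unfolding map_coeffs_def
  by (intro coeff_hom_eval_mpoly coeff_hom_compose[OF coeff_hom_Const])

lemma map_coeffs_Const: "coeff_hom h \<Longrightarrow> map_coeffs h (Const a) = Const (h a)"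
  unfolding map_coeffs_def
  by (intro eval_mpoly_Const coeff_hom_compose[OF coeff_hom_Const])

lemma map_coeffs_Var: "coeff_hom h \<Longrightarrow> map_coeffs h (Var i) = Var i"
  unfolding map_coeffs_def
  by (intro eval_mpoly_Var coeff_hom_compose[OF coeff_hom_Const])

lemma lookup_map_coeffs:
  fixes h :: "'a::comm_ring_1 \<Rightarrow> 'b::comm_ring_1" and p :: "('x, 'a) mpoly"
  assumes "coeff_hom h"
  shows "Poly_Mapping.lookup (map_coeffs h p) \<alpha> = h (Poly_Mapping.lookup p \<alpha>)"
proof -
  have "map_coeffs h p = (\<Sum>\<beta>\<in>Poly_Mapping.keys p. Const (h (Poly_Mapping.lookup p \<beta>)) * eval_monom Var \<beta>)"
    by (simp add: map_coeffs_def eval_mpoly_monom)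
  also have "\<dots> = (\<Sum>\<beta>\<in>Poly_Mapping.keys p. Poly_Mapping.single \<beta> (h (Poly_Mapping.lookup p \<beta>)))"
  proof (rule sum.cong)
    fix \<beta> :: "'x monom"
    have "eval_monom Var \<beta> = eval_mpoly Const Var (Poly_Mapping.single \<beta> (1::'b))"
      by (subst eval_mpoly_single[OF coeff_hom_Const]) (simp add: coeff_hom.one[OF coeff_hom_Const])
    then show "Const (h (Poly_Mapping.lookup p \<beta>)) * eval_monom Var \<beta> =
        Poly_Mapping.single \<beta> (h (Poly_Mapping.lookup p \<beta>))"
      by (simp add: eval_mpoly_Const_Var Const_def mult_single)
  qed simp
  finally show ?thesis
    by (simp add: lookup_sum lookup_single when_def in_keys_iff coeff_hom.zero[OF assms])
qed

lemma eval_mpoly_map_coeffs: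
  assumes "coeff_hom g" "coeff_hom h"
  shows "eval_mpoly g z (map_coeffs h p) = eval_mpoly (\<lambda>a. g (h a)) z p"
  unfolding map_coeffs_def
  by (simp add: hom_eval_mpoly[OF coeff_hom_eval_mpoly[OF assms(1)]]
      eval_mpoly_Const[OF assms(1)] eval_mpoly_Var[OF assms(1)])

section \<open>Homogeneous polynomials\<close>

lemma homogeneous_add: "homogeneous d p \<Longrightarrow> homogeneous d q \<Longrightarrow> homogeneous d (p + q)"
  using keys_add[of p q] by (auto simp: homogeneous_def)

lemma homogeneous_0: "homogeneous d 0"
  by (simp add: homogeneous_def)

lemma homogeneous_sum: "(\<And>x. x \<in> A \<Longrightarrow> homogeneous d (f x)) \<Longrightarrow> homogeneous d (sum f A)"
  by (induction A rule: infinite_finite_induct) (simp_all add: homogeneous_0 homogeneous_add)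

lemma homogeneous_mult:
  fixes p q :: "('x::finite, 'c::semiring_0) mpoly"
  shows "homogeneous a p \<Longrightarrow> homogeneous b q \<Longrightarrow> homogeneous (a + b) (p * q)"
  using keys_mult[of p q]
  by (fastforce simp: homogeneous_def monom_degree_def lookup_add sum.distrib)

lemma homogeneous_Const: "homogeneous 0 (Const a)"
  by (simp add: homogeneous_def Const_def monom_degree_def)

lemma homogeneous_Const_mult:
  "homogeneous d p \<Longrightarrow> homogeneous d (Const a * p)" for p :: "('x::finite, 'c::semiring_0) mpoly"
  using homogeneous_mult[OF homogeneous_Const, of d p a] by simp

lemma homogeneous_uminus: "homogeneous d p \<Longrightarrow> homogeneous d (- p)"
  for p :: "('x::finite, 'c::ab_group_add) mpoly"
  by (simp add: homogeneous_def in_keys_iff)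

lemma homogeneous_diff: "homogeneous d p \<Longrightarrow> homogeneous d q \<Longrightarrow> homogeneous d (p - q)"
  for p :: "('x::finite, 'c::ab_group_add) mpoly"
  using homogeneous_add[OF _ homogeneous_uminus, of d p q] by simp

lemma homogeneous_Var: "homogeneous 1 (Var i)"
  by (simp add: homogeneous_def Var_def monom_degree_def lookup_single when_def)

lemma homogeneous_1: "homogeneous 0 (1 :: ('x::finite, 'c::comm_ring_1) mpoly)"
  using homogeneous_Const[of "1::'c"] by (simp add: coeff_hom.one[OF coeff_hom_Const])

lemma homogeneous_power: "homogeneous a p \<Longrightarrow> homogeneous (a * k) (p ^ k)"
  for p :: "('x::finite, 'c::comm_ring_1) mpoly"
proof (induction k)
  case 0
  show ?case
    by (simp add: homogeneous_1)
next
  case (Suc k)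
  then show ?case
    using homogeneous_mult[of a p "a * k" "p ^ k"] by simp
qed

lemma homogeneous_Var_power: "homogeneous n (Var i ^ n :: ('x::finite, 'c::comm_ring_1) mpoly)"
  using homogeneous_power[OF homogeneous_Var, where k = n] by simp

lemma homogeneous_prod:
  fixes f :: "'i \<Rightarrow> ('x::finite, 'c::comm_ring_1) mpoly"
  shows "(\<And>i. i \<in> A \<Longrightarrow> homogeneous (d i) (f i)) \<Longrightarrow> homogeneous (sum d A) (prod f A)"
proof (induction A rule: infinite_finite_induct)
  case (insert x A)
  then show ?case
    by (simp add: homogeneous_mult)
qed (simp_all add: homogeneous_1)

lemma homogeneous_prod_list:
  fixes f :: "'i \<Rightarrow> ('x::finite, 'c::comm_ring_1) mpoly"
  shows "(\<And>i. homogeneous 1 (f i)) \<Longrightarrow> homogeneous (length is) (prod_list (map f is))"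
proof (induction "is")
  case (Cons i "is")
  then show ?case
    using homogeneous_mult[of 1 "f i"] by simp
qed (simp_all add: homogeneous_1)

text \<open>Each monomial of degree \<open>d\<close> turns into a product of \<open>d\<close> linear
  forms.\<close>

lemma homogeneous_subst:
  fixes l :: "'y::finite \<Rightarrow> ('x::finite, 'c::comm_ring_1) mpoly"
  assumes "homogeneous d p" "\<And>i. homogeneous 1 (l i)"
  shows "homogeneous d (eval_mpoly Const l p)"
  unfolding eval_mpoly_monom
proof (intro homogeneous_sum homogeneous_Const_mult)
  fix \<alpha> assume "\<alpha> \<in> Poly_Mapping.keys p"
  \<comment> \<open>The factor 1 is the degree of \<open>l i\<close>; it gives the sum the shape
    produced by \<open>homogeneous_prod\<close> and \<open>homogeneous_power\<close>.\<close>
  then have "d = (\<Sum>i\<in>UNIV. 1 * Poly_Mapping.lookup \<alpha> i)"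
    using assms(1) by (simp add: homogeneous_def monom_degree_def)
  moreover have "homogeneous (\<Sum>i\<in>UNIV. 1 * Poly_Mapping.lookup \<alpha> i)
      (\<Prod>i\<in>UNIV. l i ^ Poly_Mapping.lookup \<alpha> i)"
    by (intro homogeneous_prod homogeneous_power assms(2))
  ultimately show "homogeneous d (eval_monom l \<alpha>)"
    by (simp add: eval_monom_superset[of UNIV])
qed

section \<open>Linear changes of variables\<close>

definition mat_mult :: "('x::finite \<Rightarrow> 'x \<Rightarrow> 'c::comm_ring_1) \<Rightarrow> ('x \<Rightarrow> 'x \<Rightarrow> 'c) \<Rightarrow> 'x \<Rightarrow> 'x \<Rightarrow> 'c" where
  "mat_mult A B i j = (\<Sum>k\<in>UNIV. A i k * B k j)"

definition mat_one :: "'x \<Rightarrow> 'x \<Rightarrow> 'c::comm_ring_1" where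
  "mat_one i j = (if i = j then 1 else 0)"

definition mat_app :: "('x::finite \<Rightarrow> 'x \<Rightarrow> 'c::comm_ring_1) \<Rightarrow> ('x \<Rightarrow> 'c) \<Rightarrow> 'x \<Rightarrow> 'c" where
  "mat_app A z i = (\<Sum>k\<in>UNIV. A i k * z k)"

lemma mat_one_sum_left [simp]: "(\<Sum>k\<in>UNIV. mat_one (i::'x::finite) k * f k) = f i"
  by (simp add: mat_one_def of_bool_def[symmetric] if_distrib[of "\<lambda>x. x * _"] cong: if_cong)

lemma mat_one_sum_right [simp]: "(\<Sum>k\<in>UNIV. f k * mat_one k (j::'x::finite)) = f j"
  by (simp add: mat_one_def if_distrib[of "\<lambda>x. _ * x"] cong: if_cong)

lemma mat_app_mult: "mat_app (mat_mult A B) z = mat_app A (mat_app B z)"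
proof
  fix i
  have "mat_app (mat_mult A B) z i = (\<Sum>k\<in>UNIV. \<Sum>j\<in>UNIV. A i j * B j k * z k)"
    by (simp add: mat_app_def mat_mult_def sum_distrib_right)
  also have "\<dots> = mat_app A (mat_app B z) i"
    unfolding mat_app_def sum_distrib_left by (subst sum.swap) (simp add: mult_ac)
  finally show "mat_app (mat_mult A B) z i = mat_app A (mat_app B z) i" .
qed

lemma mat_app_one [simp]: "mat_app mat_one z = z"
  by (rule ext) (simp add: mat_app_def)

lemma mat_app_0 [simp]: "mat_app A (\<lambda>_. 0) = (\<lambda>_. 0)"
  by (rule ext) (simp add: mat_app_def)

definition lin_form :: "('x::finite \<Rightarrow> 'x \<Rightarrow> 'c::comm_ring_1) \<Rightarrow> 'x \<Rightarrow> ('x, 'c) mpoly" where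
  "lin_form B i = (\<Sum>k\<in>UNIV. Const (B i k) * Var k)"

abbreviation subst_lin :: "('x::finite \<Rightarrow> 'x \<Rightarrow> 'c::comm_ring_1) \<Rightarrow> ('x, 'c) mpoly \<Rightarrow> ('x, 'c) mpoly" where
  "subst_lin B \<equiv> eval_mpoly Const (lin_form B)"

text \<open>As a map on points this is \<open>A\<close> after \<open>F\<close> after
  \<open>B\<close>: \<open>A\<close> mixes the forms and \<open>B\<close> changes the variables, see
  \<open>eval_act\<close>.\<close>

definition act ::
  "('x::finite \<Rightarrow> 'x \<Rightarrow> 'c::comm_ring_1) \<Rightarrow> ('x \<Rightarrow> 'x \<Rightarrow> 'c) \<Rightarrow> ('x \<Rightarrow> ('x, 'c) mpoly) \<Rightarrow> 'x \<Rightarrow> ('x, 'c) mpoly" where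
  "act A B F i = (\<Sum>j\<in>UNIV. Const (A i j) * subst_lin B (F j))"

lemmas subst_simps = coeff_hom.simps[OF coeff_hom_eval_mpoly[OF coeff_hom_Const]]
  eval_mpoly_Const[OF coeff_hom_Const] eval_mpoly_Var[OF coeff_hom_Const]

lemmas Const_simps = coeff_hom.simps[OF coeff_hom_Const]

lemma homogeneous_lin_form: "homogeneous 1 (lin_form B i)"
  unfolding lin_form_def by (intro homogeneous_sum homogeneous_Const_mult homogeneous_Var)

lemma homogeneous_subst_lin: "homogeneous d p \<Longrightarrow> homogeneous d (subst_lin B p)"
  by (intro homogeneous_subst homogeneous_lin_form)

text \<open>Mixing keeps the degrees if \<open>A\<close> combines only forms of equal degree, hence
  the condition on its nonzero entries; the system for odd \<open>m\<close> may have forms of two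
  degrees.\<close>

lemma homogeneous_act:
  fixes F :: "'x::finite \<Rightarrow> ('x, 'c::comm_ring_1) mpoly"
  assumes "\<And>i. homogeneous (d i) (F i)" "\<And>i j. A i j \<noteq> 0 \<Longrightarrow> d i = d j"
  shows "homogeneous (d i) (act A B F i)"
  unfolding act_def
proof (rule homogeneous_sum)
  fix j
  show "homogeneous (d i) (Const (A i j) * subst_lin B (F j))"
  proof (cases "A i j = 0")
    case True
    then show ?thesis
      by (simp add: Const_simps homogeneous_0)
  next
    case False
    then show ?thesis
      using assms by (metis homogeneous_Const_mult homogeneous_subst_lin)
  qed
qed

lemma sum_Const_lin_form: "(\<Sum>k\<in>UNIV. Const (A i k) * lin_form B k) = lin_form (mat_mult A B) i"
proof -
  have "(\<Sum>k\<in>UNIV. Const (A i k) * lin_form B k) = (\<Sum>k\<in>UNIV. \<Sum>l\<in>UNIV. Const (A i k * B k l) * Var l)"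
    by (simp add: lin_form_def Const_simps sum_distrib_left mult_ac)
  also have "\<dots> = lin_form (mat_mult A B) i"
    by (subst sum.swap) (simp add: lin_form_def mat_mult_def Const_simps sum_distrib_right)
  finally show ?thesis .
qed

lemma subst_lin_subst_lin: "subst_lin B (subst_lin B' p) = subst_lin (mat_mult B' B) p"
proof -
  have "subst_lin B (lin_form B' i) = lin_form (mat_mult B' B) i" for i
    by (simp add: lin_form_def[of B'] subst_simps sum_Const_lin_form)
  then show ?thesis
    by (simp add: hom_eval_mpoly[OF coeff_hom_eval_mpoly[OF coeff_hom_Const]]
        eval_mpoly_Const[OF coeff_hom_Const])
qed

text \<open>Substitutions compose contravariantly, which reverses the order in the second
  matrix.\<close>

lemma act_act: "act A B (act A' B' F) = act (mat_mult A A') (mat_mult B' B) F"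
proof
  fix i
  have "act A B (act A' B' F) i =
      (\<Sum>k\<in>UNIV. \<Sum>j\<in>UNIV. Const (A i k * A' k j) * subst_lin (mat_mult B' B) (F j))"
    by (simp add: act_def subst_simps subst_lin_subst_lin sum_distrib_left Const_simps mult_ac)
  also have "\<dots> = act (mat_mult A A') (mat_mult B' B) F i"
    by (subst sum.swap) (simp add: act_def mat_mult_def Const_simps sum_distrib_right)
  finally show "act A B (act A' B' F) i = act (mat_mult A A') (mat_mult B' B) F i" .
qed

lemma Const_mat_one: "Const (mat_one i j) = mat_one i j"
  by (simp add: mat_one_def Const_simps)

lemma lin_form_mat_one: "lin_form mat_one i = (Var i :: ('x::finite, 'c::comm_ring_1) mpoly)"
  by (simp add: lin_form_def Const_mat_one)

lemma act_one: "act mat_one mat_one F = F"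
  by (rule ext) (simp add: act_def Const_mat_one lin_form_mat_one[abs_def] eval_mpoly_Const_Var)

lemma act_add: "act A B (\<lambda>i. F i + Const s * G i) i = act A B F i + Const s * act A B G i"
  by (simp add: act_def subst_simps sum.distrib sum_distrib_left algebra_simps)

lemma map_coeffs_act:
  assumes "coeff_hom h"
  shows "map_coeffs h (act A B F i) =
    act (\<lambda>i j. h (A i j)) (\<lambda>i j. h (B i j)) (\<lambda>i. map_coeffs h (F i)) i"
proof -
  interpret coeff_hom "map_coeffs h" by (rule coeff_hom_map_coeffs[OF assms])
  have "map_coeffs h (subst_lin B p) = subst_lin (\<lambda>i j. h (B i j)) (map_coeffs h p)" for p
    by (simp add: hom_eval_mpoly[OF coeff_hom_axioms] map_coeffs_Const[OF assms]
        eval_mpoly_map_coeffs[OF coeff_hom_Const assms] lin_form_def[abs_def] sum mult map_coeffs_Var[OF assms])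
  then show ?thesis
    by (simp add: act_def sum mult map_coeffs_Const[OF assms])
qed

section \<open>Common zeros of transformed systems\<close>

lemmas eval_simps = coeff_hom.simps[OF coeff_hom_eval_mpoly[OF coeff_hom_id]]
  eval_mpoly_Const[OF coeff_hom_id] eval_mpoly_Var[OF coeff_hom_id]

lemma eval_act:
  "eval_mpoly id z (act A B F i) = mat_app A (\<lambda>j. eval_mpoly id (mat_app B z) (F j)) i"
proof -
  have "eval_mpoly id z (lin_form B j) = mat_app B z j" for j
    by (simp add: lin_form_def mat_app_def eval_simps)
  then show ?thesis
    by (simp add: act_def mat_app_def[of A] eval_simps
        hom_eval_mpoly[OF coeff_hom_eval_mpoly[OF coeff_hom_id]] flip: id_def)
qed

definition has_zero :: "('x \<Rightarrow> ('x, complex) mpoly) \<Rightarrow> bool" where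
  "has_zero F \<longleftrightarrow> (\<exists>z. (\<exists>i. z i \<noteq> 0) \<and> (\<forall>i. eval_mpoly id z (F i) = 0))"

text \<open>A zero \<open>z\<close> of the transformed system gives the zero
  \<open>mat_app B z\<close> of \<open>F\<close>: the left inverse of \<open>A\<close> removes the
  mixing, and that of \<open>B\<close> keeps the point nonzero.\<close>

lemma has_zero_act_imp:
  assumes "mat_mult A' A = mat_one" "mat_mult B' B = mat_one" "has_zero (act A B F)"
  shows "has_zero F"
proof -
  obtain z i where z: "z i \<noteq> 0" "\<And>i. eval_mpoly id z (act A B F i) = 0"
    using assms(3) by (auto simp: has_zero_def)
  have "mat_app A (\<lambda>j. eval_mpoly id (mat_app B z) (F j)) = (\<lambda>_. 0)"
    using z(2) by (auto simp: eval_act)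
  then have "eval_mpoly id (mat_app B z) (F j) = 0" for j
    by (metis assms(1) mat_app_mult mat_app_one mat_app_0)
  moreover have "\<exists>i. mat_app B z i \<noteq> 0"
  proof (rule ccontr)
    assume "\<not> (\<exists>i. mat_app B z i \<noteq> 0)"
    then have "mat_app B z = (\<lambda>_. 0)"
      by auto
    then have "z = (\<lambda>_. 0)"
      by (metis assms(2) mat_app_mult mat_app_one mat_app_0)
    then show False
      using z(1) by simp
  qed
  ultimately show ?thesis
    by (auto simp: has_zero_def)
qed

lemma has_zero_act:
  assumes "mat_mult A A' = mat_one" "mat_mult A' A = mat_one"
    "mat_mult B B' = mat_one" "mat_mult B' B = mat_one"
  shows "has_zero (act A B F) \<longleftrightarrow> has_zero F"
  using has_zero_act_imp[of A' A B' B F] has_zero_act_imp[of A A' B B' "act A B F"] assms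
  by (auto simp: act_act act_one)

text \<open>The linear map that scales the line spanned by \<open>w\<close> by the factor \<open>c\<close> and is the identity
  on its orthogonal complement; for \<open>c = -1\<close> it is a reflection.\<close>

definition scale_along :: "('x \<Rightarrow> 'c) \<Rightarrow> 'c \<Rightarrow> 'x \<Rightarrow> 'x \<Rightarrow> 'c::comm_ring_1" where
  "scale_along w c i j = mat_one i j + (c - 1) * (w i * w j)"

lemma scale_along_1: "scale_along w 1 = mat_one"
  by (intro ext) (simp add: scale_along_def)

text \<open>For a unit vector \<open>w\<close> the factors multiply; so the reflection is an
  involution, and over the complex numbers every nonzero factor gives an invertible map.\<close>

lemma scale_along_mult:
  fixes w :: "'x::finite \<Rightarrow> 'c::comm_ring_1"
  assumes "(\<Sum>i\<in>UNIV. w i * w i) = 1"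
  shows "mat_mult (scale_along w c) (scale_along w c') = scale_along w (c * c')"
proof (intro ext)
  fix i j
  have "mat_mult (scale_along w c) (scale_along w c') i j =
    (\<Sum>k\<in>UNIV. mat_one i k * mat_one k j) + (\<Sum>k\<in>UNIV. mat_one i k * ((c' - 1) * (w k * w j)))
     + (\<Sum>k\<in>UNIV. (c - 1) * (w i * w k) * mat_one k j)
     + (c - 1) * (c' - 1) * w i * w j * (\<Sum>k\<in>UNIV. w k * w k)"
    by (simp only: mat_mult_def scale_along_def distrib_left distrib_right sum.distrib
        sum_distrib_left) (simp add: mult_ac)
  also have "\<dots> = scale_along w (c * c') i j"
    by (simp only: mat_one_sum_left mat_one_sum_right assms scale_along_def) (simp add: algebra_simps)
  finally show "mat_mult (scale_along w c) (scale_along w c') i j = scale_along w (c * c') i j" .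
qed

text \<open>Conjugating the reflection in \<open>w\<close> by the reflection in \<open>q\<close>
  gives the reflection in the image of \<open>w\<close>. The equations avoid inverses and match the
  two matrix products that \<open>act_act\<close> produces.\<close>

lemma reflection_conjugation:
  fixes w q :: "'x::finite \<Rightarrow> 'c::comm_ring_1"
  assumes "(\<Sum>i\<in>UNIV. q i * q i) = 1"
  defines "w' \<equiv> mat_app (scale_along q (-1)) w"
  shows "mat_mult (scale_along w (-1)) (scale_along q (-1)) = mat_mult (scale_along q (-1)) (scale_along w' (-1))"
    and "mat_mult (scale_along q (-1)) (scale_along w (-1)) = mat_mult (scale_along w' (-1)) (scale_along q (-1))"
proof -
  define a where "a = (\<Sum>i\<in>UNIV. w i * q i)"
  have w': "w' i = w i - 2 * a * q i" for i
  proof -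
    have "w' i = (\<Sum>k\<in>UNIV. mat_one i k * w k) - (\<Sum>k\<in>UNIV. 2 * (w k * q k) * q i)"
      by (simp only: w'_def mat_app_def scale_along_def distrib_right sum.distrib flip: sum_subtractf)
        (simp add: algebra_simps sum.distrib sum_subtractf sum_negf)
    then show ?thesis
      by (simp only: mat_one_sum_left) (simp add: a_def sum_distrib_left sum_distrib_right mult_ac)
  qed
  \<comment> \<open>The product of two Householder matrices in closed form, for arbitrary
    vectors.\<close>
  have mm: "mat_mult (scale_along u (-1)) (scale_along v (-1)) i j =
     mat_one i j - 2 * u i * u j - 2 * v i * v j + 4 * (\<Sum>k\<in>UNIV. u k * v k) * u i * v j"
    for u v :: "'x \<Rightarrow> 'c" and i j
  proof -
    have "mat_mult (scale_along u (-1)) (scale_along v (-1)) i j =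
    (\<Sum>k\<in>UNIV. mat_one i k * mat_one k j) + (\<Sum>k\<in>UNIV. mat_one i k * (-2 * (v k * v j)))
     + (\<Sum>k\<in>UNIV. -2 * (u i * u k) * mat_one k j)
     + 4 * (u i * v j) * (\<Sum>k\<in>UNIV. u k * v k)"
      by (simp only: mat_mult_def scale_along_def distrib_left distrib_right sum.distrib
          sum_distrib_left) (simp add: mult_ac)
    then show ?thesis
      by (simp only: mat_one_sum_left mat_one_sum_right) (simp add: algebra_simps)
  qed
  \<comment> \<open>The reflection in \<open>q\<close> reverses the component along
    \<open>q\<close>.\<close>
  have qw: "(\<Sum>k\<in>UNIV. q k * w' k) = - a"
  proof -
    have "(\<Sum>k\<in>UNIV. q k * w' k) = (\<Sum>k\<in>UNIV. w k * q k) - 2 * a * (\<Sum>k\<in>UNIV. q k * q k)"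
      by (simp add: w' algebra_simps sum_subtractf sum_distrib_left)
    then show ?thesis
      by (simp only: assms(1) flip: a_def) simp
  qed
  have comm: "(\<Sum>k\<in>UNIV. u k * v k) = (\<Sum>k\<in>UNIV. v k * u k)" for u v :: "'x \<Rightarrow> 'c"
    by (simp add: mult.commute)
  show "mat_mult (scale_along w (-1)) (scale_along q (-1)) = mat_mult (scale_along q (-1)) (scale_along w' (-1))"
    by (intro ext, simp only: mm qw a_def[symmetric]) (simp add: w' algebra_simps)
  show "mat_mult (scale_along q (-1)) (scale_along w (-1)) = mat_mult (scale_along w' (-1)) (scale_along q (-1))"
    by (intro ext, simp only: mm comm[of q w] comm[of w' q] qw a_def[symmetric]) (simp add: w' algebra_simps)
qed

section \<open>Constancy of the ratio of values along a connected family\<close>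

text \<open>Up to the leading coefficient, which cancels in the ratio, such a polynomial is
  determined by the multiplicities of its roots in \<open>Z\<close>, and each of these is at most
  \<open>D\<close>.\<close>

lemma finite_root_ratios:
  fixes Z :: "complex set"
  assumes "finite Z" "0 \<notin> Z"
  shows "finite ((\<lambda>p. poly p 1 / poly p 0) ` {p. {s. poly p s = 0} = Z \<and> degree p \<le> D})"
    (is "finite (?r ` ?P)")
proof -
  define f where "f m = (\<Prod>z\<in>Z. (1 - z) ^ m z) / (\<Prod>z\<in>Z. (- z) ^ m z)" for m :: "complex \<Rightarrow> nat"
  have "?r ` ?P \<subseteq> f ` (PiE Z (\<lambda>_. {..D}))"
  proof clarsimp
    fix p :: "complex poly"
    assume p: "Z = {s. poly p s = 0}" "degree p \<le> D"
    then have "p \<noteq> 0"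
      using assms by auto
    \<comment> \<open>The restriction makes the multiplicities a member of the finite set
      \<open>PiE Z (\<lambda>_. {..D})\<close>.\<close>
    define m where "m = restrict (\<lambda>z. order z p) {s. poly p s = 0}"
    have "poly p x = lead_coeff p * (\<Prod>z\<in>Z. (x - z) ^ m z)" for x
      by (subst complex_poly_decompose[symmetric]) (simp add: poly_prod p m_def)
    then have "?r p = f m"
      using \<open>p \<noteq> 0\<close> by (simp add: f_def)
    moreover have "m \<in> PiE Z (\<lambda>_. {..D})"
      using p order_degree[OF \<open>p \<noteq> 0\<close>] by (auto simp: m_def intro: order_trans)
    ultimately show "?r p \<in> f ` (PiE {s. poly p s = 0} (\<lambda>_. {..D}))"
      using p by auto
  qed
  moreover have "finite (f ` (PiE Z (\<lambda>_. {..D})))"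
    using assms(1) by (intro finite_imageI finite_PiE) auto
  ultimately show ?thesis
    by (rule finite_subset)
qed

text \<open>The bound is crude but depends on \<open>R\<close> alone, so it is uniform over all
  lines in the space of systems.\<close>

lemma degree_eval_mpoly_le:
  fixes R :: "('x, int) mpoly" and a b :: "'x \<Rightarrow> 'c::idom"
  shows "degree (eval_mpoly of_int (\<lambda>v. [:a v, b v:]) R) \<le>
    (\<Sum>\<mu>\<in>Poly_Mapping.keys R. \<Sum>v\<in>Poly_Mapping.keys \<mu>. Poly_Mapping.lookup \<mu> v)"
  unfolding eval_mpoly_def
proof (rule degree_sum_le)
  fix \<mu> assume \<mu>: "\<mu> \<in> Poly_Mapping.keys R"
  let ?q = "\<lambda>v. [:a v, b v:] ^ Poly_Mapping.lookup \<mu> v"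
  have "degree (?q v) \<le> Poly_Mapping.lookup \<mu> v" for v
    by (rule order_trans[OF degree_power_le]) simp
  then have "degree (\<Prod>v\<in>Poly_Mapping.keys \<mu>. ?q v) \<le> (\<Sum>v\<in>Poly_Mapping.keys \<mu>. Poly_Mapping.lookup \<mu> v)"
    by (intro order_trans[OF degree_prod_sum_le] sum_mono) auto
  moreover have "degree (of_int (Poly_Mapping.lookup R \<mu>) * (\<Prod>v\<in>Poly_Mapping.keys \<mu>. ?q v)) \<le>
      degree (\<Prod>v\<in>Poly_Mapping.keys \<mu>. ?q v)"
    by (rule order_trans[OF degree_mult_le]) simp
  moreover have "(\<Sum>v\<in>Poly_Mapping.keys \<mu>. Poly_Mapping.lookup \<mu> v) \<le>
      (\<Sum>\<mu>\<in>Poly_Mapping.keys R. \<Sum>v\<in>Poly_Mapping.keys \<mu>. Poly_Mapping.lookup \<mu> v)"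
    using \<mu> by (intro member_le_sum) auto
  ultimately show "degree (of_int (Poly_Mapping.lookup R \<mu>) * (\<Prod>v\<in>Poly_Mapping.keys \<mu>. ?q v)) \<le>
      (\<Sum>\<mu>\<in>Poly_Mapping.keys R. \<Sum>v\<in>Poly_Mapping.keys \<mu>. Poly_Mapping.lookup \<mu> v)"
    by linarith
qed simp

section \<open>Values along a line of systems\<close>

abbreviation value_at :: "('x coeff_var, int) mpoly \<Rightarrow> ('x \<Rightarrow> ('x, 'c::comm_ring_1) mpoly) \<Rightarrow> 'c" where
  "value_at R F \<equiv> eval_mpoly of_int (coeffs_of F) R"

definition detects_zeros :: "('x::finite \<Rightarrow> nat) \<Rightarrow> ('x coeff_var, int) mpoly \<Rightarrow> bool" where
  "detects_zeros d R \<longleftrightarrow>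
     (\<forall>F. (\<forall>i. homogeneous (d i) (F i)) \<longrightarrow> (value_at R F = 0 \<longleftrightarrow> has_zero F))"

text \<open>Along the line through \<open>F\<close> in direction \<open>G\<close> the coefficients
  are affine in \<open>s\<close>, so \<open>R\<close> restricts to a polynomial in one
  variable.\<close>

lemma poly_value_at_line:
  fixes F G :: "'x \<Rightarrow> ('x, complex) mpoly"
  shows "poly (eval_mpoly of_int (\<lambda>v. [:coeffs_of F v, coeffs_of G v:]) R) s =
    value_at R (\<lambda>i. F i + Const s * G i)"
proof -
  have "coeffs_of (\<lambda>i. F i + Const s * G i) = (\<lambda>v. coeffs_of F v + s * coeffs_of G v)"
  proof
    fix v
    have "Poly_Mapping.lookup (Const s * p) \<alpha> = s * Poly_Mapping.lookup p \<alpha>"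
      for p :: "('x, complex) mpoly" and \<alpha>
    proof -
      have "Const s * p = (\<Sum>\<beta>\<in>Poly_Mapping.keys p. Poly_Mapping.single \<beta> (s * Poly_Mapping.lookup p \<beta>))"
        by (subst mpoly_sum_single[of p]) (simp add: Const_def sum_distrib_left mult_single)
      then show ?thesis
        by (simp add: lookup_sum lookup_single when_def in_keys_iff)
    qed
    then show "coeffs_of (\<lambda>i. F i + Const s * G i) v = coeffs_of F v + s * coeffs_of G v"
      by (cases v) (simp add: coeffs_of_def lookup_add)
  qed
  then show ?thesis
    by (simp add: hom_eval_mpoly[OF coeff_hom_poly] coeff_hom.of_int[OF coeff_hom_poly])
qed

text \<open>Here \<open>\<Phi>\<close> is any continuous family of linear, zero-preserving maps of
  systems over a connected parameter set. The roots on the line from \<open>F\<close> to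
  \<open>G\<close> do not move with the parameter, so the ratio has finitely many values, and
  connectedness makes it constant.\<close>

lemma value_ratio_constant:
  fixes \<Phi> :: "'t::topological_space \<Rightarrow> ('x::finite \<Rightarrow> ('x, complex) mpoly) \<Rightarrow> 'x \<Rightarrow> ('x, complex) mpoly"
  assumes R: "detects_zeros d R" and S: "connected S"
    and hom: "\<And>t F i. t \<in> S \<Longrightarrow> (\<And>i. homogeneous (d i) (F i)) \<Longrightarrow> homogeneous (d i) (\<Phi> t F i)"
    and zero: "\<And>t F. t \<in> S \<Longrightarrow> has_zero (\<Phi> t F) \<longleftrightarrow> has_zero F"
    and lin: "\<And>t F s G. \<Phi> t (\<lambda>i. F i + Const s * G i) = (\<lambda>i. \<Phi> t F i + Const s * \<Phi> t G i)"
    and cont: "\<And>F v. continuous_on S (\<lambda>t. coeffs_of (\<Phi> t F) v)"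
    and F: "\<And>i. homogeneous (d i) (F i)" and G: "\<And>i. homogeneous (d i) (G i)"
    and nz: "value_at R F \<noteq> 0"
    and t: "t \<in> S" "t' \<in> S"
  shows "value_at R (\<Phi> t G) / value_at R (\<Phi> t F) = value_at R (\<Phi> t' G) / value_at R (\<Phi> t' F)"
proof -
  define H where "H i = G i - F i" for i
  have H: "homogeneous (d i) (H i)" for i
    unfolding H_def by (intro homogeneous_diff F G)
  define L where "L s i = F i + Const s * H i" for s i
  have L: "homogeneous (d i) (L s i)" for s i
    unfolding L_def by (intro homogeneous_add homogeneous_Const_mult F H)
  have ends: "L 0 = F" "L 1 = G"
    by (auto simp: L_def H_def Const_simps)
  define p where "p t = eval_mpoly of_int (\<lambda>v. [:coeffs_of (\<Phi> t F) v, coeffs_of (\<Phi> t H) v:]) R" for t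
  have p: "poly (p t) s = value_at R (\<Phi> t (L s))" for t s
    unfolding p_def L_def[abs_def] lin by (rule poly_value_at_line)
  have root: "poly (p t) s = 0 \<longleftrightarrow> value_at R (L s) = 0" if "t \<in> S" for t s
    using R hom[OF that L] zero[OF that] L by (auto simp: p detects_zeros_def)
  define Z where "Z = {s. value_at R (L s) = 0}"
  \<comment> \<open>As \<open>R\<close> does not vanish at \<open>F = L 0\<close>, the point 0 is no
    root; for \<open>t\<close> in \<open>S\<close> this keeps \<open>p t\<close> nonzero and the
    denominator of the ratio away from 0.\<close>
  have "0 \<notin> Z"
    using nz by (simp add: Z_def ends)
  have Z: "{s. poly (p t) s = 0} = Z" if "t \<in> S" for t
    using root[OF that] by (auto simp: Z_def)
  have "p t \<noteq> 0"
    using Z[OF t(1)] \<open>0 \<notin> Z\<close> by auto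
  then have "finite Z"
    using Z[OF t(1)] poly_roots_finite by metis
  obtain D where D: "degree (p t) \<le> D" for t
    unfolding p_def using degree_eval_mpoly_le by blast
  let ?r = "\<lambda>t. value_at R (\<Phi> t G) / value_at R (\<Phi> t F)"
  have r: "?r t = poly (p t) 1 / poly (p t) 0" for t
    by (simp add: p ends)
  have "?r ` S \<subseteq> (\<lambda>p. poly p 1 / poly p 0) ` {p. {s. poly p s = 0} = Z \<and> degree p \<le> D}"
    unfolding r using Z D by blast
  then have "finite (?r ` S)"
    by (rule finite_subset) (rule finite_root_ratios[OF \<open>finite Z\<close> \<open>0 \<notin> Z\<close>])
  moreover have "continuous_on S ?r"
  proof (intro continuous_on_divide ballI)
    have "continuous_on S (\<lambda>t. value_at R (\<Phi> t K))" for K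
      unfolding eval_mpoly_def by (intro continuous_intros cont)
    then show "continuous_on S (\<lambda>t. value_at R (\<Phi> t F))" "continuous_on S (\<lambda>t. value_at R (\<Phi> t G))"
      by auto
    show "value_at R (\<Phi> t F) \<noteq> 0" if "t \<in> S" for t
      using root[OF that, of 0] p[of t 0] nz by (simp add: ends)
  qed
  ultimately have "?r constant_on S"
    using continuous_finite_range_constant[OF S] by blast
  then show ?thesis
    using t by (auto simp: constant_on_def)
qed

section \<open>Invariance under reflections\<close>

abbreviation reflect :: "('x::finite \<Rightarrow> 'c::comm_ring_1) \<Rightarrow> ('x \<Rightarrow> ('x, 'c) mpoly) \<Rightarrow> 'x \<Rightarrow> ('x, 'c) mpoly" where
  "reflect w \<equiv> act (scale_along w (-1)) (scale_along w (-1))"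

text \<open>An off-diagonal entry is a multiple of \<open>w i * w j\<close>, so only indices in the
  support of \<open>w\<close> are mixed.\<close>

lemma scale_along_degree:
  assumes "scale_along w c i j \<noteq> 0" "\<And>i j. w i \<noteq> 0 \<Longrightarrow> w j \<noteq> 0 \<Longrightarrow> d i = d j"
  shows "d i = d j"
  using assms(2)[of i j] assms(1)
  by (cases "i = j") (auto simp: scale_along_def mat_one_def dest!: mult_not_zero)

lemma has_zero_scale_along:
  fixes w :: "'x::finite \<Rightarrow> complex"
  assumes "(\<Sum>i\<in>UNIV. w i * w i) = 1" "c \<noteq> 0"
  shows "has_zero (act (scale_along w c) (scale_along w c) F) \<longleftrightarrow> has_zero F"
  by (rule has_zero_act[of _ "scale_along w (1 / c)" _ "scale_along w (1 / c)"])
    (simp_all add: scale_along_mult[OF assms(1)] assms(2) scale_along_1)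

text \<open>Each coefficient is a polynomial in \<open>c\<close>: the action is carried out over
  \<open>complex poly\<close> with the indeterminate as factor and then evaluated at
  \<open>c\<close>.\<close>

lemma continuous_scale_along:
  fixes w :: "'x::finite \<Rightarrow> complex"
  shows "continuous_on S (\<lambda>c. coeffs_of (act (scale_along w c) (scale_along w c) F) v)"
proof -
  define W where "W = scale_along (\<lambda>i. [:w i:]) [:0, 1:]"
  have W: "(\<lambda>i j. poly (W i j) c) = scale_along w c" for c
    by (intro ext) (simp add: W_def scale_along_def mat_one_def algebra_simps)
  have F: "map_coeffs (\<lambda>p. poly p c) (map_coeffs (\<lambda>a. [:a:]) p) = p" for p :: "('x, complex) mpoly" and c
    by (rule poly_mapping_eqI)
      (simp add: lookup_map_coeffs[OF coeff_hom_poly] lookup_map_coeffs[OF coeff_hom_pConst])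
  have "coeffs_of (act (scale_along w c) (scale_along w c) F) v =
     poly (coeffs_of (act W W (\<lambda>i. map_coeffs (\<lambda>a. [:a:]) (F i))) v) c" for c
    by (cases v) (simp add: coeffs_of_def map_coeffs_act[OF coeff_hom_poly] W F
        flip: lookup_map_coeffs[OF coeff_hom_poly])
  then show ?thesis
    by (simp add: continuous_on_poly)
qed

lemma value_reflect_ratio:
  fixes w :: "'x::finite \<Rightarrow> complex"
  assumes R: "detects_zeros d R"
    and w: "(\<Sum>i\<in>UNIV. w i * w i) = 1" "\<And>i j. w i \<noteq> 0 \<Longrightarrow> w j \<noteq> 0 \<Longrightarrow> d i = d j"
    and F: "\<And>i. homogeneous (d i) (F i)" and G: "\<And>i. homogeneous (d i) (G i)"
    and nz: "value_at R F \<noteq> 0"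
  shows "value_at R (reflect w G) / value_at R (reflect w F) = value_at R G / value_at R F"
proof -
  let ?\<Phi> = "\<lambda>c. act (scale_along w c) (scale_along w c)"
  have "value_at R (?\<Phi> (-1) G) / value_at R (?\<Phi> (-1) F) = value_at R (?\<Phi> 1 G) / value_at R (?\<Phi> 1 F)"
  proof (rule value_ratio_constant[OF R, where \<Phi> = ?\<Phi> and S = "- {0}"])
    \<comment> \<open>Complex factors matter here: on the real line, removing 0 would separate 1
      from -1.\<close>
    show "connected (- {0 :: complex})"
      by (rule connected_punctured_universe) simp
    show "homogeneous (d i) (?\<Phi> c K i)" if "\<And>i. homogeneous (d i) (K i)" for c K i
      by (rule homogeneous_act[OF that]) (rule scale_along_degree[OF _ w(2)])
    show "has_zero (?\<Phi> c K) \<longleftrightarrow> has_zero K" if "c \<in> - {0}" for c K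
      using has_zero_scale_along[OF w(1)] that by simp
    show "?\<Phi> c (\<lambda>i. K i + Const s * L i) = (\<lambda>i. ?\<Phi> c K i + Const s * ?\<Phi> c L i)" for c K L s
      by (rule ext) (rule act_add)
  qed (use F G nz in \<open>simp_all add: continuous_scale_along\<close>)
  then show ?thesis
    by (simp only: scale_along_1 act_one)
qed

text \<open>By the constant ratio it suffices to have one system \<open>G\<close> without common
  zero that is fixed by the reflection in \<open>w\<close>. The system \<open>H\<close> has this
  property for the basis vector of \<open>i0\<close>; a second reflection, which swaps
  \<open>w\<close> with that basis vector, carries \<open>H\<close> to \<open>G\<close>.\<close>

lemma value_reflect:
  fixes w :: "'x::finite \<Rightarrow> real" and i0 :: 'x
  assumes R: "detects_zeros d R"
    and w: "(\<Sum>i\<in>UNIV. w i * w i) = 1" "\<And>i. w i \<noteq> 0 \<Longrightarrow> d i = d i0"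
    and H: "\<And>i. homogeneous (d i) (H i)" "\<not> has_zero H" "reflect (mat_one i0) H = H"
    and F: "\<And>i. homogeneous (d i) (F i)"
  shows "value_at R (reflect (\<lambda>i. complex_of_real (w i)) F) = value_at R F"
proof -
  let ?w = "\<lambda>i. complex_of_real (w i)"
  have w_unit: "(\<Sum>i\<in>UNIV. ?w i * ?w i) = 1"
    using w(1) by (metis (mono_tags, lifting) of_real_1 of_real_mult of_real_sum sum.cong)
  have hom: "homogeneous (d i) (reflect u K i)"
    if "\<And>i. homogeneous (d i) (K i)" "\<And>i. u i \<noteq> 0 \<Longrightarrow> d i = d i0" for u :: "'x \<Rightarrow> complex" and K i
    by (rule homogeneous_act[OF that(1)]) (rule scale_along_degree, assumption, metis that(2))
  obtain G where G: "\<And>i. homogeneous (d i) (G i)" "\<not> has_zero G" "reflect ?w G = G"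
  \<comment> \<open>If \<open>w\<close> is the basis vector itself, the difference \<open>D\<close>
    vanishes and defines no mirror; then \<open>H\<close> already serves as
    \<open>G\<close>.\<close>
  proof (cases "w = mat_one i0")
    case True
    then have "?w = mat_one i0"
      by (auto simp: mat_one_def)
    then show ?thesis
      using that H by metis
  next
    case False
    \<comment> \<open>The vector \<open>q\<close> is the unit normal of the mirror between
      \<open>w\<close> and the basis vector. Since the entries are real, a nonzero \<open>D\<close>
      has nonzero length.\<close>
    define D where "D i = w i - mat_one i0 i" for i
    define r where "r = sqrt (\<Sum>i\<in>UNIV. D i * D i)"
    define q where "q i = D i / r" for i
    obtain j where "D j \<noteq> 0"
      using False by (auto simp: D_def fun_eq_iff)
    then have "(\<Sum>i\<in>UNIV. D i * D i) > 0"
      by (intro sum_pos2[of _ j]) (auto simp flip: power2_eq_square)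
    then have r: "r * r = (\<Sum>i\<in>UNIV. D i * D i)" "r \<noteq> 0"
      by (simp_all add: r_def)
    have "(\<Sum>i\<in>UNIV. D i * D i) =
        (\<Sum>i\<in>UNIV. w i * w i) - 2 * (\<Sum>i\<in>UNIV. mat_one i0 i * w i) + (\<Sum>i\<in>UNIV. mat_one i0 i * mat_one i0 i)"
      unfolding sum_distrib_left sum_subtractf[symmetric] sum.distrib[symmetric]
      by (simp add: D_def algebra_simps)
    then have r2: "r * r = 2 - 2 * w i0"
      by (simp only: r(1) w(1) mat_one_sum_left) (simp add: mat_one_def)
    have q_unit: "(\<Sum>i\<in>UNIV. q i * q i) = 1"
      using r(2) by (simp add: q_def flip: sum_divide_distrib r(1))
    have "(\<Sum>i\<in>UNIV. q i * w i) = ((\<Sum>i\<in>UNIV. w i * w i) - (\<Sum>i\<in>UNIV. mat_one i0 i * w i)) / r"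
      unfolding sum_divide_distrib sum_subtractf[symmetric] by (simp add: q_def D_def algebra_simps)
    then have qw: "(\<Sum>i\<in>UNIV. q i * w i) = r / 2"
      using r2 r(2) by (simp only: mat_one_sum_left w(1)) (simp add: field_simps)
    have Hh: "mat_app (scale_along q (-1)) w = mat_one i0"
    proof
      fix i
      have "mat_app (scale_along q (-1)) w i = (\<Sum>k\<in>UNIV. mat_one i k * w k) - 2 * q i * (\<Sum>k\<in>UNIV. q k * w k)"
        by (simp only: mat_app_def scale_along_def sum_distrib_left sum_subtractf[symmetric])
          (simp add: algebra_simps)
      then show "mat_app (scale_along q (-1)) w i = mat_one i0 i"
        using r(2) by (simp only: mat_one_sum_left qw) (simp add: q_def D_def field_simps)
    qed
    let ?q = "\<lambda>i. complex_of_real (q i)"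
    have q_unit': "(\<Sum>i\<in>UNIV. ?q i * ?q i) = 1"
      using q_unit by (metis (mono_tags, lifting) of_real_1 of_real_mult of_real_sum sum.cong)
    have sc: "scale_along ?q (-1) i k = complex_of_real (scale_along q (-1) i k)" for i k
      by (simp add: scale_along_def mat_one_def)
    have Hh': "mat_app (scale_along ?q (-1)) ?w = mat_one i0"
    proof
      fix i
      have "mat_app (scale_along ?q (-1)) ?w i = complex_of_real (mat_app (scale_along q (-1)) w i)"
        by (simp add: mat_app_def sc)
      then show "mat_app (scale_along ?q (-1)) ?w i = mat_one i0 i"
        by (simp add: Hh mat_one_def)
    qed
    show ?thesis
    proof (rule that[of "reflect ?q H"])
      \<comment> \<open>The support of \<open>q\<close> lies in that of \<open>w\<close> together
        with \<open>i0\<close>, and all degrees there equal \<open>d i0\<close>.\<close>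
      show "homogeneous (d i) (reflect ?q H i)" for i
        by (rule hom[OF H(1)]) (use w(2) in \<open>auto simp: q_def D_def mat_one_def split: if_splits\<close>)
      show "\<not> has_zero (reflect ?q H)"
        using has_zero_scale_along[OF q_unit'] H(2) by simp
      \<comment> \<open>Conjugation turns the reflection in \<open>w\<close> into the one in the
        basis vector, which fixes \<open>H\<close>.\<close>
      have "reflect ?w (reflect ?q H) = reflect ?q (reflect (mat_one i0) H)"
        unfolding act_act reflection_conjugation[OF q_unit', of ?w] Hh' ..
      then show "reflect ?w (reflect ?q H) = reflect ?q H"
        by (simp only: H(3))
    qed
  qed
  have homF: "homogeneous (d i) (reflect ?w F i)" for i
    by (rule hom[OF F]) (use w(2) in simp)
  show ?thesis
  proof (cases "value_at R F = 0")
    case True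
    then have "has_zero (reflect ?w F)"
      using R F has_zero_scale_along[OF w_unit] by (auto simp: detects_zeros_def)
    then show ?thesis
      using R homF True by (simp add: detects_zeros_def)
  next
    case False
    have nz: "value_at R G \<noteq> 0"
      using R G by (simp add: detects_zeros_def)
    have "value_at R (reflect ?w F) / value_at R (reflect ?w G) = value_at R F / value_at R G"
      by (rule value_reflect_ratio[OF R w_unit _ G(1) F nz]) (metis of_real_0 w(2))
    then show ?thesis
      using nz by (simp add: G(3))
  qed
qed

text \<open>The reflection in a basis vector is a diagonal sign matrix, so only form
  \<open>i0\<close> and variable \<open>i0\<close> change sign.\<close>

lemma reflect_mat_one:
  fixes H :: "'x::finite \<Rightarrow> ('x, 'c::comm_ring_1) mpoly"
  defines "\<epsilon> \<equiv> \<lambda>i0 i. if i = i0 then - 1 else 1"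
  shows "reflect (mat_one i0) H i = \<epsilon> i0 i * eval_mpoly Const (\<lambda>i. \<epsilon> i0 i * Var i) (H i)"
proof -
  have e: "Const (scale_along (mat_one i0) (-1) i j :: 'c) = mat_one i j * \<epsilon> i0 i" for i j
  proof -
    have "scale_along (mat_one i0) (-1) i j = (mat_one i j * (if i = i0 then - 1 else 1) :: 'c)"
      by (auto simp: scale_along_def mat_one_def)
    then show ?thesis
      by (simp add: mat_one_def \<epsilon>_def Const_simps)
  qed
  have l: "lin_form (scale_along (mat_one i0) (-1) :: 'x \<Rightarrow> 'x \<Rightarrow> 'c) = (\<lambda>i. \<epsilon> i0 i * Var i)"
    by (rule ext) (simp add: lin_form_def e mult.assoc)
  show ?thesis
    by (simp add: act_def e l mult.assoc)
qed

text \<open>Pure powers work for odd \<open>d i0\<close>: the sign from the substitution cancels the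
  sign of form \<open>i0\<close>.\<close>

lemma invariant_system_odd:
  fixes d :: "'x::finite \<Rightarrow> nat"
  assumes "odd (d i0)" "\<And>i. d i > 0"
  obtains H :: "'x \<Rightarrow> ('x, complex) mpoly"
  where "\<And>i. homogeneous (d i) (H i)" "\<not> has_zero H" "reflect (mat_one i0) H = H"
proof
  let ?H = "\<lambda>i. Var i ^ d i :: ('x, complex) mpoly"
  show "homogeneous (d i) (?H i)" for i
    by (rule homogeneous_Var_power)
  show "\<not> has_zero ?H"
    using assms(2) by (auto simp: has_zero_def eval_simps)
  show "reflect (mat_one i0) ?H = ?H"
    using assms(1) by (intro ext) (auto simp: reflect_mat_one subst_simps power_mult_distrib)
qed

text \<open>For even \<open>d i0\<close> the form \<open>i0\<close> must be odd in its own variable,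
  so a second variable is brought in: \<open>Var i0 ^ (d i0 - 1) * Var k\<close> is odd, and adding
  \<open>Var i0 ^ d k\<close> to form \<open>k\<close> keeps that form even while forcing both
  coordinates to vanish together.\<close>

lemma invariant_system_even:
  fixes d :: "'x::finite \<Rightarrow> nat"
  assumes "even (d i0)" "even (d k)" "k \<noteq> i0" "\<And>i. d i > 0"
  obtains H :: "'x \<Rightarrow> ('x, complex) mpoly"
  where "\<And>i. homogeneous (d i) (H i)" "\<not> has_zero H" "reflect (mat_one i0) H = H"
proof
  let ?H = "\<lambda>i. if i = i0 then Var i0 ^ (d i0 - 1) * Var k
    else if i = k then Var i0 ^ d k + Var k ^ d k else Var i ^ d i :: ('x, complex) mpoly"
  have odd: "odd (d i0 - 1)"
    using assms(1) assms(4)[of i0] by simp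
  show "homogeneous (d i) (?H i)" for i
    using homogeneous_mult[OF homogeneous_Var_power[of "d i0 - 1" i0] homogeneous_Var[of k]] assms(4)[of i0]
    by (auto intro: homogeneous_Var_power homogeneous_add)
  show "\<not> has_zero ?H"
  proof
    assume "has_zero ?H"
    then obtain z j where z: "z j \<noteq> 0" "\<And>i. eval_mpoly id z (?H i) = 0"
      by (auto simp: has_zero_def)
    have "z i0 ^ d k + z k ^ d k = 0" "z i0 ^ (d i0 - 1) * z k = 0"
      using z(2)[of k] z(2)[of i0] assms(3) by (auto simp: eval_simps)
    then have "z i0 = 0" "z k = 0"
      using assms(4)[of k] by (auto simp: zero_power)
    moreover have "z i = 0" if "i \<noteq> i0" "i \<noteq> k" for i
      using z(2)[of i] that by (auto simp: eval_simps)
    ultimately show False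
      using z(1) by metis
  qed
  show "reflect (mat_one i0) ?H = ?H"
    using assms(2,3) odd
    by (intro ext) (auto simp: reflect_mat_one subst_simps power_mult_distrib)
qed

section \<open>Frames and hypermatrices\<close>

text \<open>The remainder is orthogonal to the frame, hence to its span, which contains the
  remainder itself.\<close>

lemma frame_expansion:
  fixes e :: "'n::finite \<Rightarrow> 'v::euclidean_space"
  assumes "orthonormal_frame e"
  shows "(\<Sum>j\<in>UNIV. (v \<bullet> e j) *\<^sub>R e j) = v"
proof -
  let ?y = "v - (\<Sum>j\<in>UNIV. (v \<bullet> e j) *\<^sub>R e j)"
  have y: "?y \<bullet> e i = 0" for i
  proof -
    have "(\<Sum>j\<in>UNIV. (v \<bullet> e j) *\<^sub>R e j) \<bullet> e i = (\<Sum>j\<in>UNIV. if j = i then v \<bullet> e j else 0)"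
      unfolding inner_sum_left
      by (rule sum.cong) (use assms in \<open>simp_all add: orthonormal_frame_def\<close>)
    then show ?thesis
      by (simp add: inner_diff_left)
  qed
  have "?y \<in> span (range e)"
    using assms by (simp add: orthonormal_frame_def)
  then have "orthogonal ?y ?y"
    by (rule orthogonal_to_span) (use y in \<open>auto simp: orthogonal_def\<close>)
  then show ?thesis
    by (simp add: orthogonal_def)
qed

section \<open>Reflected frames\<close>

abbreviation reflect_frame :: "'v::euclidean_space \<Rightarrow> ('n \<Rightarrow> 'v) \<Rightarrow> 'n \<Rightarrow> 'v" where
  "reflect_frame u e \<equiv> \<lambda>i. e i - (2 * (e i \<bullet> u)) *\<^sub>R u"

lemma orthonormal_frame_reflect:
  assumes "orthonormal_frame e" "norm u = 1"
  shows "orthonormal_frame (reflect_frame u e)"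
proof -
  have u: "u \<bullet> u = 1"
    using assms(2) by (simp add: dot_square_norm)
  have "v \<in> span (range (reflect_frame u e))" for v
  proof -
    \<comment> \<open>As \<open>v\<close> is the mirror image of \<open>?v\<close>, expanding
      \<open>?v\<close> in \<open>e\<close> and reflecting term by term puts \<open>v\<close> into
      the span.\<close>
    let ?v = "v - (2 * (v \<bullet> u)) *\<^sub>R u"
    have "v = ?v - (2 * (?v \<bullet> u)) *\<^sub>R u"
      by (simp add: inner_diff_left u)
    also have "\<dots> = (\<Sum>j\<in>UNIV. (?v \<bullet> e j) *\<^sub>R e j) - (2 * ((\<Sum>j\<in>UNIV. (?v \<bullet> e j) *\<^sub>R e j) \<bullet> u)) *\<^sub>R u"
      by (simp only: frame_expansion[OF assms(1)])
    also have "\<dots> = (\<Sum>j\<in>UNIV. (?v \<bullet> e j) *\<^sub>R reflect_frame u e j)"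
      by (simp add: inner_sum_left sum_distrib_left scaleR_sum_left scaleR_diff_right sum_subtractf mult_ac)
    also have "\<dots> \<in> span (range (reflect_frame u e))"
      by (intro span_sum span_scale span_base) auto
    finally show ?thesis .
  qed
  moreover have "reflect_frame u e i \<bullet> reflect_frame u e j = e i \<bullet> e j" for i j
    by (simp add: inner_diff_left inner_diff_right u) (simp add: inner_commute)
  ultimately show ?thesis
    using assms(1) by (auto simp: orthonormal_frame_def)
qed

text \<open>The reflection that swaps \<open>e i\<close> and \<open>e' i\<close> fixes every common vector of the two frames, so
  it makes them agree in one more index.\<close>

lemma frame_reflection_invariant:
  fixes e e' :: "'n::finite \<Rightarrow> 'v::euclidean_space"
  assumes step: "\<And>e u. orthonormal_frame e \<Longrightarrow> norm u = 1 \<Longrightarrow> Q (reflect_frame u e) = Q e"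
    and "orthonormal_frame e" "orthonormal_frame e'"
  shows "Q e = Q e'"
  using assms(2)
proof (induction "card {i. e i \<noteq> e' i}" arbitrary: e rule: less_induct)
  case less
  show ?case
  proof (cases "\<exists>i. e i \<noteq> e' i")
    case False
    then have "e = e'"
      by auto
    then show ?thesis
      by simp
  next
    case True
    then obtain i where i: "e i \<noteq> e' i"
      by blast
    define r where "r = norm (e i - e' i)"
    define u where "u = (1 / r) *\<^sub>R (e i - e' i)"
    have r: "r \<noteq> 0"
      using i by (simp add: r_def)
    then have u: "norm u = 1"
      by (simp add: u_def r_def)
    have on: "e j \<bullet> e k = (if j = k then 1 else 0)" "e' j \<bullet> e' k = (if j = k then 1 else 0)" for j k
      using less.prems assms(3) by (auto simp: orthonormal_frame_def)
    \<comment> \<open>For unit vectors this equals \<open>2 - 2 * (e i \<bullet> e' i)\<close>,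
      which is why the reflection in \<open>u\<close> sends \<open>e i\<close> exactly to
      \<open>e' i\<close>.\<close>
    have "r * r = (e i - e' i) \<bullet> (e i - e' i)"
      by (simp add: r_def dot_square_norm power2_eq_square)
    then have "r * r = 2 - 2 * (e i \<bullet> e' i)"
      by (simp add: inner_diff_left inner_diff_right on) (simp add: inner_commute)
    then have "2 * (e i \<bullet> u) = r"
      using r by (simp add: u_def inner_diff_right on field_simps)
    then have "reflect_frame u e i = e' i"
      using r by (simp add: u_def)
    moreover have "reflect_frame u e j = e' j" if "e j = e' j" for j
    proof -
      have "j \<noteq> i"
        using i that by auto
      then have "e j \<bullet> e i = 0" "e j \<bullet> e' i = 0"
        using on(1)[of j i] on(2)[of j i] that by auto
      then have "e j \<bullet> u = 0"
        by (simp add: u_def inner_diff_right)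
      then show ?thesis
        using that by simp
    qed
    ultimately have "{i. reflect_frame u e i \<noteq> e' i} \<subset> {i. e i \<noteq> e' i}"
      using i by blast
    then have "card {i. reflect_frame u e i \<noteq> e' i} < card {i. e i \<noteq> e' i}"
      by (intro psubset_card_mono) auto
    then have "Q (reflect_frame u e) = Q e'"
      by (rule less.hyps) (rule orthonormal_frame_reflect[OF less.prems u])
    then show ?thesis
      using step[OF less.prems u] by simp
  qed
qed

section \<open>Multilinearity and change of frame\<close>

lemma 
  fixes L :: "'v::real_vector list \<Rightarrow> complex"
  assumes "complex_tensor (Suc n) L"
  shows complex_tensor_Cons: "complex_tensor n (\<lambda>vs. L (v # vs))"
    and linear_tensor_hd: "length vs = n \<Longrightarrow> linear (\<lambda>v. L (v # vs))"
proof -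
  have lin: "linear (\<lambda>x. L (vs[i := x]))" if "length vs = Suc n" "i < Suc n" for vs i
    using assms that by (simp add: complex_tensor_def)
  have "linear (\<lambda>x. L (v # vs[i := x]))" if "length vs = n" "i < n" for vs i
    using lin[of "v # vs" "Suc i"] that by simp
  then show "complex_tensor n (\<lambda>vs. L (v # vs))"
    by (simp add: complex_tensor_def)
  show "linear (\<lambda>v. L (v # vs))" if "length vs = n"
    \<comment> \<open>The head 0 is a placeholder; the update at position 0 overwrites it.\<close>
    using lin[of "0 # vs" 0] that by simp
qed

lemma sum_lists_Suc:
  fixes f :: "'n::finite list \<Rightarrow> 'r::comm_monoid_add"
  shows "(\<Sum>is | length is = Suc n. f is) = (\<Sum>i\<in>UNIV. \<Sum>is | length is = n. f (i # is))"
  unfolding sum.cartesian_product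
  by (rule sum.reindex_bij_witness[of _ "\<lambda>(i, is). i # is" "\<lambda>is. (hd is, tl is)"])
    (auto simp: length_Suc_conv)

lemma tensor_expand:
  fixes S :: "'n::finite \<Rightarrow> 'n \<Rightarrow> real"
  assumes "coeff_hom c" "complex_tensor (Suc n) L" "length vs = n"
  shows "c (L ((\<Sum>j\<in>UNIV. S i j *\<^sub>R e j) # vs)) = (\<Sum>j\<in>UNIV. c (of_real (S i j)) * c (L (e j # vs)))"
proof -
  interpret linear "\<lambda>v. L (v # vs)"
    by (rule linear_tensor_hd[OF assms(2,3)])
  show ?thesis
    by (simp add: sum scale scaleR_conv_of_real coeff_hom.simps[OF assms(1)])
qed

text \<open>Moving the frame coefficients from the slots of \<open>L\<close> to the variables
  replaces \<open>x\<close> by the transpose of \<open>S\<close> applied to \<open>x\<close>. The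
  induction freezes the first slot, changes the others and then expands the first.\<close>

lemma tensor_sum_change:
  fixes S :: "'n::finite \<Rightarrow> 'n \<Rightarrow> real" and c :: "complex \<Rightarrow> 'r::comm_ring_1"
  assumes c: "coeff_hom c" and "complex_tensor n L" and e': "\<And>i. e' i = (\<Sum>j\<in>UNIV. S i j *\<^sub>R e j)"
  shows "(\<Sum>is | length is = n. c (L (map e' is)) * prod_list (map x is)) =
    (\<Sum>is | length is = n. c (L (map e is)) *
       prod_list (map (\<lambda>j. \<Sum>i\<in>UNIV. c (of_real (S i j)) * x i) is))"
  using assms(2)
proof (induction n arbitrary: L)
  case 0
  then show ?case
    by simp
next
  case (Suc n)
  let ?y = "\<lambda>j. \<Sum>i\<in>UNIV. c (of_real (S i j)) * x i"
  have "(\<Sum>is | length is = Suc n. c (L (map e' is)) * prod_list (map x is)) =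
      (\<Sum>i\<in>UNIV. x i * (\<Sum>is | length is = n. c (L (e' i # map e' is)) * prod_list (map x is)))"
    by (simp add: sum_lists_Suc sum_distrib_left mult_ac)
  also have "\<dots> = (\<Sum>i\<in>UNIV. x i * (\<Sum>is | length is = n. c (L (e' i # map e is)) * prod_list (map ?y is)))"
    by (simp only: Suc.IH[OF complex_tensor_Cons[OF Suc.prems]])
  also have "\<dots> = (\<Sum>i\<in>UNIV. \<Sum>j\<in>UNIV. \<Sum>is | length is = n.
      (c (of_real (S i j)) * x i) * (c (L (e j # map e is)) * prod_list (map ?y is)))"
  proof (rule sum.cong)
    fix i
    have "(\<Sum>is | length is = n. c (L (e' i # map e is)) * prod_list (map ?y is)) =
        (\<Sum>is | length is = n. \<Sum>j\<in>UNIV. c (of_real (S i j)) * (c (L (e j # map e is)) * prod_list (map ?y is)))"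
    proof (rule sum.cong)
      fix "is" :: "'n list" assume "is \<in> {is. length is = n}"
      then have "c (L (e' i # map e is)) = (\<Sum>j\<in>UNIV. c (of_real (S i j)) * c (L (e j # map e is)))"
        unfolding e' by (intro tensor_expand[OF c Suc.prems]) simp
      then show "c (L (e' i # map e is)) * prod_list (map ?y is) =
          (\<Sum>j\<in>UNIV. c (of_real (S i j)) * (c (L (e j # map e is)) * prod_list (map ?y is)))"
        by (simp add: sum_distrib_right mult.assoc)
    qed simp
    also have "\<dots> = (\<Sum>j\<in>UNIV. \<Sum>is | length is = n. c (of_real (S i j)) * (c (L (e j # map e is)) * prod_list (map ?y is)))"
      by (rule sum.swap)
    finally show "x i * (\<Sum>is | length is = n. c (L (e' i # map e is)) * prod_list (map ?y is)) =
        (\<Sum>j\<in>UNIV. \<Sum>is | length is = n. (c (of_real (S i j)) * x i) * (c (L (e j # map e is)) * prod_list (map ?y is)))"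
      by (simp only: sum_distrib_left mult_ac)
  qed simp
  also have "\<dots> = (\<Sum>j\<in>UNIV. \<Sum>i\<in>UNIV. (c (of_real (S i j)) * x i) *
      (\<Sum>is | length is = n. c (L (e j # map e is)) * prod_list (map ?y is)))"
    by (subst sum.swap) (simp only: sum_distrib_left)
  also have "\<dots> = (\<Sum>j\<in>UNIV. ?y j * (\<Sum>is | length is = n. c (L (e j # map e is)) * prod_list (map ?y is)))"
    by (simp only: sum_distrib_right)
  also have "\<dots> = (\<Sum>is | length is = Suc n. c (L (map e is)) * prod_list (map ?y is))"
    by (simp only: sum_lists_Suc sum_distrib_left list.map prod_list.Cons mult_ac)
  finally show ?case .
qed

text \<open>One slot stays free, so \<open>S\<close> acts on the components and its transpose on
  \<open>x\<close>; the map \<open>c\<close> allows \<open>x\<close> to consist of polynomial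
  variables.\<close>

lemma hm_apply_change:
  fixes S :: "'n::finite \<Rightarrow> 'n \<Rightarrow> real" and c :: "complex \<Rightarrow> 'r::comm_ring_1"
  assumes c: "coeff_hom c" and T: "complex_tensor m T" "m \<ge> 1"
    and e': "\<And>i. e' i = (\<Sum>j\<in>UNIV. S i j *\<^sub>R e j)"
  shows "hm_apply m c (hypermatrix T e') x i =
    (\<Sum>j\<in>UNIV. c (of_real (S i j)) *
       hm_apply m c (hypermatrix T e) (\<lambda>j. \<Sum>i\<in>UNIV. c (of_real (S i j)) * x i) j)"
proof -
  obtain n where n: "m = Suc n"
    using T(2) by (cases m) auto
  let ?y = "\<lambda>j. \<Sum>i\<in>UNIV. c (of_real (S i j)) * x i"
  have T': "complex_tensor (Suc n) T"
    using T n by simp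
  have "hm_apply m c (hypermatrix T e') x i =
      (\<Sum>is | length is = n. c (T (e' i # map e is)) * prod_list (map ?y is))"
    using tensor_sum_change[OF c complex_tensor_Cons[OF T'] e', where x = x]
    by (simp add: hm_apply_def hypermatrix_def n)
  also have "\<dots> = (\<Sum>is | length is = n. \<Sum>j\<in>UNIV. c (of_real (S i j)) * (c (T (e j # map e is)) * prod_list (map ?y is)))"
  proof (rule sum.cong)
    fix "is" :: "'n list" assume "is \<in> {is. length is = n}"
    then have "c (T (e' i # map e is)) = (\<Sum>j\<in>UNIV. c (of_real (S i j)) * c (T (e j # map e is)))"
      unfolding e' by (intro tensor_expand[OF c T']) simp
    then show "c (T (e' i # map e is)) * prod_list (map ?y is) =
        (\<Sum>j\<in>UNIV. c (of_real (S i j)) * (c (T (e j # map e is)) * prod_list (map ?y is)))"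
      by (simp add: sum_distrib_right mult.assoc)
  qed simp
  also have "\<dots> = (\<Sum>j\<in>UNIV. c (of_real (S i j)) * hm_apply m c (hypermatrix T e) ?y j)"
    by (subst sum.swap) (simp only: hm_apply_def hypermatrix_def n list.map sum_distrib_left diff_Suc_1)
  finally show ?thesis .
qed

text \<open>The vector \<open>w\<close> collects the coordinates of \<open>u\<close>, so reflecting
  the frame in \<open>u\<close> is given by the matrix of a reflection of coordinate space.\<close>

lemma reflect_frame_expansion:
  fixes e :: "'n::finite \<Rightarrow> 'v::euclidean_space"
  assumes "orthonormal_frame e" "norm u = 1"
  defines "w \<equiv> \<lambda>i. e i \<bullet> u"
  shows "(\<Sum>i\<in>UNIV. w i * w i) = 1"
    and "reflect_frame u e i = (\<Sum>j\<in>UNIV. scale_along w (-1) i j *\<^sub>R e j)"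
proof -
  have u: "(\<Sum>j\<in>UNIV. w j *\<^sub>R e j) = u"
    using frame_expansion[OF assms(1), of u] by (simp add: w_def inner_commute)
  have "(\<Sum>j\<in>UNIV. w j * w j) = (\<Sum>j\<in>UNIV. w j *\<^sub>R e j) \<bullet> u"
    by (simp add: inner_sum_left w_def)
  then show "(\<Sum>i\<in>UNIV. w i * w i) = 1"
    using assms(2) by (simp add: u dot_square_norm)
  have "(\<Sum>j\<in>UNIV. scale_along w (-1) i j *\<^sub>R e j) =
      (\<Sum>j\<in>UNIV. mat_one i j *\<^sub>R e j) - (2 * w i) *\<^sub>R (\<Sum>j\<in>UNIV. w j *\<^sub>R e j)"
    by (simp add: scale_along_def scaleR_sum_right scaleR_diff_left sum_subtractf mult_ac)
  also have "(\<Sum>j\<in>UNIV. mat_one i j *\<^sub>R e j) = e i"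
    by (simp add: mat_one_def if_distrib[of "\<lambda>a. a *\<^sub>R _"] cong: if_cong)
  finally show "reflect_frame u e i = (\<Sum>j\<in>UNIV. scale_along w (-1) i j *\<^sub>R e j)"
    by (simp add: u) (simp add: w_def)
qed

section \<open>The forms attached to a tensor\<close>

lemma homogeneous_hm_apply:
  fixes x :: "'n::finite \<Rightarrow> ('x::finite, complex) mpoly"
  assumes "\<And>i. homogeneous 1 (x i)"
  shows "homogeneous (m - 1) (hm_apply m Const A x i)"
  unfolding hm_apply_def
proof (intro homogeneous_sum homogeneous_Const_mult)
  fix "is" :: "'n list" assume "is \<in> {is. length is = m - 1}"
  then show "homogeneous (m - 1) (prod_list (map x is))"
    using homogeneous_prod_list[of x "is"] assms by simp
qed

lemma hom_hm_apply:
  assumes "coeff_hom g"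
  shows "g (hm_apply m c A x i) = hm_apply m (\<lambda>a. g (c a)) A (\<lambda>i. g (x i)) i"
  by (simp add: hm_apply_def coeff_hom.simps[OF assms] comp_def)

lemma scale_along_sym: "scale_along w c i j = scale_along w c j i"
  by (simp add: scale_along_def mat_one_def mult.commute)

lemma of_real_scale_along:
  "complex_of_real (scale_along w (-1) i j) = scale_along (\<lambda>i. complex_of_real (w i)) (-1) i j"
  by (simp add: scale_along_def mat_one_def)

lemma act_diff: "act A B (\<lambda>i. F i - G i) i = act A B F i - act A B G i"
  by (simp add: act_def subst_simps sum_subtractf right_diff_distrib)

text \<open>The outer reflection undoes the one in the variables because it is an involution. The
  premise covers just the forms mixed into component \<open>i\<close>, so that for odd
  \<open>m\<close> the quadratic form is exempt.\<close>

lemma reflect_multiple_of_Var: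
  fixes w :: "'x::finite \<Rightarrow> 'c::comm_ring_1"
  assumes "(\<Sum>i\<in>UNIV. w i * w i) = 1"
    and "\<And>j. scale_along w (-1) i j \<noteq> 0 \<Longrightarrow> subst_lin (scale_along w (-1)) (F j) = P * lin_form (scale_along w (-1)) j"
  shows "reflect w F i = P * Var i"
proof -
  let ?s = "scale_along w (-1)"
  have "Const (?s i j) * subst_lin ?s (F j) = P * (Const (?s i j) * lin_form ?s j)" for j
    using assms(2)[of j] by (cases "?s i j = 0") (simp_all add: Const_simps mult_ac)
  then have "reflect w F i = P * (\<Sum>j\<in>UNIV. Const (?s i j) * lin_form ?s j)"
    by (simp add: act_def sum_distrib_left)
  then show ?thesis
    by (simp add: sum_Const_lin_form scale_along_mult[OF assms(1)] scale_along_1 lin_form_mat_one)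
qed

text \<open>The matrix of the reflection is symmetric and its own inverse, hence orthogonal.\<close>

lemma sum_squares_lin_form:
  fixes w :: "'x::finite \<Rightarrow> 'c::comm_ring_1"
  assumes "(\<Sum>i\<in>UNIV. w i * w i) = 1"
  shows "(\<Sum>i\<in>UNIV. (lin_form (scale_along w (-1)) i)\<^sup>2) = (\<Sum>i\<in>UNIV. (Var i)\<^sup>2)"
proof -
  let ?s = "scale_along w (-1)"
  have "(\<Sum>i\<in>UNIV. (lin_form ?s i)\<^sup>2) = (\<Sum>i\<in>UNIV. \<Sum>j\<in>UNIV. Var j * (Const (?s j i) * lin_form ?s i))"
  proof (rule sum.cong)
    fix i
    have "(lin_form ?s i)\<^sup>2 = (\<Sum>j\<in>UNIV. Const (?s i j) * Var j) * lin_form ?s i"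
      by (simp add: power2_eq_square lin_form_def)
    then show "(lin_form ?s i)\<^sup>2 = (\<Sum>j\<in>UNIV. Var j * (Const (?s j i) * lin_form ?s i))"
      by (simp only: sum_distrib_right scale_along_sym[of w _ _ i]) (simp only: mult_ac)
  qed simp
  also have "\<dots> = (\<Sum>j\<in>UNIV. Var j * (\<Sum>i\<in>UNIV. Const (?s j i) * lin_form ?s i))"
    by (subst sum.swap) (simp only: sum_distrib_left)
  also have "\<dots> = (\<Sum>j\<in>UNIV. (Var j)\<^sup>2)"
    by (simp add: sum_Const_lin_form scale_along_mult[OF assms] scale_along_1 lin_form_mat_one power2_eq_square)
  finally show ?thesis .
qed

text \<open>The transpose in \<open>hm_apply_change\<close> disappears by symmetry, so the same
  matrix \<open>s\<close> acts outside and inside.\<close>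

lemma hm_apply_reflect_frame:
  fixes e :: "'n::finite \<Rightarrow> 'v::euclidean_space"
  assumes "complex_tensor m T" "m \<ge> 1" "orthonormal_frame e" "norm u = 1"
  defines "s \<equiv> scale_along (\<lambda>i. complex_of_real (e i \<bullet> u)) (-1)"
  shows "hm_apply m Const (hypermatrix T (reflect_frame u e)) x i =
    (\<Sum>j\<in>UNIV. Const (s i j) * hm_apply m Const (hypermatrix T e) (\<lambda>j. \<Sum>i\<in>UNIV. Const (s j i) * x i) j)"
  unfolding hm_apply_change[OF coeff_hom_Const assms(1,2) reflect_frame_expansion(2)[OF assms(3,4)]]
    of_real_scale_along s_def
  by (subst scale_along_sym) (rule refl)

text \<open>This is the bridge from frames to systems: a reflection of the frame becomes the action
  on forms treated by \<open>value_reflect\<close>.\<close>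

lemma reflect_hm_apply:
  fixes e :: "'n::finite \<Rightarrow> 'v::euclidean_space"
  assumes "complex_tensor m T" "m \<ge> 1" "orthonormal_frame e" "norm u = 1"
  shows "reflect (\<lambda>i. complex_of_real (e i \<bullet> u)) (hm_apply m Const (hypermatrix T e) Var) i =
    hm_apply m Const (hypermatrix T (reflect_frame u e)) Var i"
  by (simp add: act_def hom_hm_apply[OF coeff_hom_eval_mpoly[OF coeff_hom_Const]] subst_simps
      hm_apply_reflect_frame[OF assms] lin_form_def)

lemma sum_option: "(\<Sum>k\<in>UNIV. f k) = f None + (\<Sum>i\<in>UNIV. f (Some i))"
  for f :: "'n::finite option \<Rightarrow> 'c::comm_monoid_add"
  by (simp add: UNIV_option_conv sum.reindex)

text \<open>Extending the vector by 0 at \<open>None\<close> makes the reflection fix the additional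
  variable and keep form \<open>None\<close> apart from the others.\<close>

lemma reflect_hm_apply_option:
  fixes e :: "'n::finite \<Rightarrow> 'v::euclidean_space"
  assumes "complex_tensor m T" "m \<ge> 1" "orthonormal_frame e" "norm u = 1"
    and F: "\<And>i. F (Some i) = hm_apply m Const (hypermatrix T e) (\<lambda>j. Var (Some j)) i"
  shows "reflect (case_option 0 (\<lambda>i. complex_of_real (e i \<bullet> u))) F (Some i) =
    hm_apply m Const (hypermatrix T (reflect_frame u e)) (\<lambda>j. Var (Some j)) i"
proof -
  let ?w = "\<lambda>i. complex_of_real (e i \<bullet> u)"
  have s: "scale_along (case_option 0 ?w) (-1) (Some i) (Some j) = scale_along ?w (-1) i j"
    "scale_along (case_option 0 ?w) (-1) (Some i) None = 0" for i j
    by (simp_all add: scale_along_def mat_one_def)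
  show ?thesis
    by (simp add: act_def sum_option F hom_hm_apply[OF coeff_hom_eval_mpoly[OF coeff_hom_Const]] subst_simps
        hm_apply_reflect_frame[OF assms(1-4)] lin_form_def s Const_simps)
qed

section \<open>Invariance of the resultants\<close>

lemma detects_zeros_resultant: "is_resultant_poly d R \<Longrightarrow> detects_zeros d R"
  unfolding is_resultant_poly_def detects_zeros_def has_zero_def by blast

text \<open>The candidate values for \<open>F\<close> and \<open>G\<close> form the same set, so
  both definite descriptions have the same predicate.\<close>

lemma resultant_cong:
  assumes "\<And>R. detects_zeros d R \<Longrightarrow> value_at R F = value_at R G"
  shows "resultant d F = resultant d G"
proof -
  have "(\<exists>R. is_resultant_poly d R \<and> v = value_at R F) \<longleftrightarrow>
      (\<exists>R. is_resultant_poly d R \<and> v = value_at R G)" for v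
    using assms detects_zeros_resultant by metis
  then show ?thesis
    by (simp add: resultant_def)
qed

text \<open>As \<open>R\<close> has integer coefficients, taking its value commutes with
  specializing \<lambda> to a number \<open>l\<close>.\<close>

lemma poly_value_at:
  fixes F :: "'x \<Rightarrow> ('x, complex poly) mpoly"
  shows "poly (value_at R F) l = value_at R (\<lambda>i. map_coeffs (\<lambda>p. poly p l) (F i))"
proof -
  have "coeffs_of (\<lambda>i. map_coeffs (\<lambda>p. poly p l) (F i)) = (\<lambda>v. poly (coeffs_of F v) l)"
    by (auto simp: coeffs_of_def lookup_map_coeffs[OF coeff_hom_poly])
  then show ?thesis
    by (simp add: hom_eval_mpoly[OF coeff_hom_poly] coeff_hom.of_int[OF coeff_hom_poly])
qed

text \<open>Complex polynomials with equal values everywhere are equal; this reduces forms over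
  \<open>complex poly\<close> to complex forms, to which \<open>detects_zeros\<close>
  applies.\<close>

lemma resultant_poly_cong:
  fixes F G :: "'x::finite \<Rightarrow> ('x, complex poly) mpoly"
  assumes "\<And>R l. detects_zeros d R \<Longrightarrow>
    value_at R (\<lambda>i. map_coeffs (\<lambda>p. poly p l) (F i)) = value_at R (\<lambda>i. map_coeffs (\<lambda>p. poly p l) (G i))"
  shows "resultant d F = resultant d G"
proof (rule resultant_cong)
  fix R assume "detects_zeros d R"
  then have "poly (value_at R F) = poly (value_at R G)"
    by (intro ext) (simp add: poly_value_at assms)
  then show "value_at R F = value_at R G"
    by (simp add: poly_eq_poly_eq_iff)
qed

text \<open>For even \<open>m\<close> the degree \<open>m - 1\<close> is odd and pure powers are a
  fixed system; for odd \<open>m\<close> a second index is called for, which is where the dimension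
  bound enters.\<close>

lemma hm_resultant_reflect:
  fixes e :: "'n::finite \<Rightarrow> 'v::euclidean_space"
  assumes T: "complex_tensor m T" "m \<ge> 2" and e: "orthonormal_frame e" "norm u = 1"
    and m: "even m \<or> CARD('n) \<ge> 2"
  shows "hm_resultant m (hypermatrix T (reflect_frame u e)) = hm_resultant m (hypermatrix T e)"
  unfolding hm_resultant_def
proof (rule resultant_cong)
  fix R :: "('n coeff_var, int) mpoly" assume R: "detects_zeros (\<lambda>_. m - 1) R"
  let ?F = "hm_apply m Const (hypermatrix T e) Var"
  \<comment> \<open>Any index will do; types are nonempty.\<close>
  fix i0 :: 'n
  obtain H :: "'n \<Rightarrow> ('n, complex) mpoly"
    where H: "\<And>i. homogeneous (m - 1) (H i)" "\<not> has_zero H" "reflect (mat_one i0) H = H"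
  proof (cases "even m")
    case True
    then show ?thesis
      using invariant_system_odd[of "\<lambda>_. m - 1" i0] T(2) that by auto
  next
    case False
    then have "\<not> UNIV \<subseteq> {i0}"
      using m card_mono[of "{i0}" "UNIV :: 'n set"] by auto
    then obtain k where "k \<noteq> i0"
      by auto
    then show ?thesis
      using invariant_system_even[of "\<lambda>_. m - 1" i0 k] T(2) that False by auto
  qed
  have "value_at R (reflect (\<lambda>i. complex_of_real (e i \<bullet> u)) ?F) = value_at R ?F"
    by (rule value_reflect[OF R reflect_frame_expansion(1)[OF e] _ H])
      (rule refl, rule homogeneous_hm_apply[OF homogeneous_Var])
  moreover have "reflect (\<lambda>i. complex_of_real (e i \<bullet> u)) ?F =
      hm_apply m Const (hypermatrix T (reflect_frame u e)) Var"
    by (rule ext) (rule reflect_hm_apply[OF T(1) _ e], use T(2) in simp)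
  ultimately show "value_at R (hm_apply m Const (hypermatrix T (reflect_frame u e)) Var) = value_at R ?F"
    by simp
qed

section \<open>Specializing \<lambda> in the E-characteristic forms\<close>

lemma map_coeffs_E_forms_even:
  "map_coeffs (\<lambda>p. poly p l) (E_forms_even m A i) =
    hm_apply m Const A Var i - Const l * (\<Sum>j\<in>UNIV. (Var j)\<^sup>2) ^ ((m - 2) div 2) * Var i"
  by (simp add: E_forms_even_def lam_def hom_hm_apply[OF coeff_hom_map_coeffs[OF coeff_hom_poly]]
      coeff_hom.simps[OF coeff_hom_map_coeffs[OF coeff_hom_poly]] map_coeffs_Const[OF coeff_hom_poly]
      map_coeffs_Var[OF coeff_hom_poly])

lemma map_coeffs_E_forms_odd:
  "map_coeffs (\<lambda>p. poly p l) (E_forms_odd m A k) =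
    (case k of
       Some i \<Rightarrow> hm_apply m Const A (\<lambda>j. Var (Some j)) i - Const l * Var None ^ (m - 2) * Var (Some i)
     | None \<Rightarrow> (\<Sum>j\<in>UNIV. (Var (Some j))\<^sup>2) - (Var None)\<^sup>2)"
  by (cases k) (simp_all add: E_forms_odd_def lam_def hom_hm_apply[OF coeff_hom_map_coeffs[OF coeff_hom_poly]]
      coeff_hom.simps[OF coeff_hom_map_coeffs[OF coeff_hom_poly]] map_coeffs_Const[OF coeff_hom_poly]
      map_coeffs_Var[OF coeff_hom_poly])

text \<open>The term in \<lambda> is an invariant factor times the vector of variables, so the
  reflection fixes it and changes only the tensor part.\<close>

lemma E_forms_even_resultant_reflect:
  fixes e :: "'n::finite \<Rightarrow> 'v::euclidean_space"
  assumes T: "complex_tensor m T" "m \<ge> 2" "even m" and e: "orthonormal_frame e" "norm u = 1"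
  shows "resultant (\<lambda>_. m - 1) (E_forms_even m (hypermatrix T (reflect_frame u e))) =
    resultant (\<lambda>_. m - 1) (E_forms_even m (hypermatrix T e))"
proof (rule resultant_poly_cong)
  fix R :: "('n coeff_var, int) mpoly" and l :: complex
  assume R: "detects_zeros (\<lambda>_. m - 1) R"
  let ?w = "\<lambda>i. complex_of_real (e i \<bullet> u)"
  define Q :: "('n, complex) mpoly" where "Q = (\<Sum>j\<in>UNIV. (Var j)\<^sup>2)"
  define G where "G i = Const l * Q ^ ((m - 2) div 2) * Var i" for i
  define F where "F e' i = hm_apply m Const (hypermatrix T e') Var i - G i" for e' :: "'n \<Rightarrow> 'v" and i
  have w: "(\<Sum>i\<in>UNIV. ?w i * ?w i) = 1"
    using reflect_frame_expansion(1)[OF e] by (metis (mono_tags, lifting) of_real_1 of_real_mult of_real_sum sum.cong)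
  have homQ: "homogeneous 2 Q"
    unfolding Q_def by (intro homogeneous_sum homogeneous_Var_power)
  \<comment> \<open>Evenness of \<open>m\<close> makes the division exact, so both parts of a form
    have the same degree.\<close>
  have "2 * ((m - 2) div 2) + 1 = m - 1"
    using T(2,3) by (auto elim!: evenE)
  then have homG: "homogeneous (m - 1) (G i)" for i
    using homogeneous_mult[OF homogeneous_Const_mult[OF homogeneous_power[OF homQ]] homogeneous_Var]
    unfolding G_def by metis
  have homF: "homogeneous (m - 1) (F e' i)" for e' i
    unfolding F_def by (intro homogeneous_diff homogeneous_hm_apply homogeneous_Var homG)
  fix i0 :: 'n
  obtain H :: "'n \<Rightarrow> ('n, complex) mpoly"
    where H: "\<And>i. homogeneous (m - 1) (H i)" "\<not> has_zero H" "reflect (mat_one i0) H = H"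
    using invariant_system_odd[of "\<lambda>_. m - 1" i0] T(2,3) by auto
  have "subst_lin (scale_along ?w (-1)) Q = Q"
    by (simp add: Q_def subst_simps sum_squares_lin_form[OF w])
  then have "reflect ?w G i = G i" for i
    unfolding G_def by (intro reflect_multiple_of_Var[OF w]) (simp add: subst_simps)
  then have "reflect ?w (F e) = F (reflect_frame u e)"
    using reflect_hm_apply[OF T(1) _ e] T(2) by (intro ext) (simp add: F_def[abs_def] act_diff)
  moreover have "value_at R (reflect ?w (F e)) = value_at R (F e)"
    by (rule value_reflect[OF R reflect_frame_expansion(1)[OF e] _ H homF]) (rule refl)
  ultimately have "value_at R (F (reflect_frame u e)) = value_at R (F e)"
    by simp
  then show "value_at R (\<lambda>i. map_coeffs (\<lambda>p. poly p l) (E_forms_even m (hypermatrix T (reflect_frame u e)) i)) =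
      value_at R (\<lambda>i. map_coeffs (\<lambda>p. poly p l) (E_forms_even m (hypermatrix T e) i))"
    by (simp add: map_coeffs_E_forms_even F_def[abs_def] G_def Q_def)
qed

text \<open>The index \<open>None\<close> has even degree 2 and serves as the second index in
  \<open>invariant_system_even\<close>, so dimension 1 is included.\<close>

lemma E_forms_odd_resultant_reflect:
  fixes e :: "'n::finite \<Rightarrow> 'v::euclidean_space"
  assumes T: "complex_tensor m T" "m \<ge> 2" "odd m" and e: "orthonormal_frame e" "norm u = 1"
  defines "d \<equiv> \<lambda>k. case k of Some _ \<Rightarrow> m - 1 | None \<Rightarrow> 2"
  shows "resultant d (E_forms_odd m (hypermatrix T (reflect_frame u e))) =
    resultant d (E_forms_odd m (hypermatrix T e))"
proof (rule resultant_poly_cong)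
  fix R :: "('n option coeff_var, int) mpoly" and l :: complex
  assume R: "detects_zeros d R"
  let ?w = "case_option 0 (\<lambda>i. e i \<bullet> u)"
  let ?wc = "\<lambda>k. complex_of_real (?w k)"
  have wc: "?wc = case_option 0 (\<lambda>i. complex_of_real (e i \<bullet> u))"
    by (auto split: option.split)
  have w_unit: "(\<Sum>k\<in>UNIV. ?w k * ?w k) = 1"
    using reflect_frame_expansion(1)[OF e] by (simp add: sum_option)
  then have wc_unit: "(\<Sum>k\<in>UNIV. ?wc k * ?wc k) = 1"
    by (metis (mono_tags, lifting) of_real_1 of_real_mult of_real_sum sum.cong)
  let ?s = "scale_along ?wc (-1)"
  define L where "L e' k = (case k of Some i \<Rightarrow> hm_apply m Const (hypermatrix T e') (\<lambda>j. Var (Some j)) i | None \<Rightarrow> 0)"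
    for e' :: "'n \<Rightarrow> 'v" and k :: "'n option"
  define P where "P = (Const l * Var None ^ (m - 2) :: ('n option, complex) mpoly)"
  define q where "q = ((\<Sum>j\<in>UNIV. (Var (Some j))\<^sup>2) - (Var None)\<^sup>2 :: ('n option, complex) mpoly)"
  \<comment> \<open>The sign at \<open>None\<close> is chosen so that \<open>L e' - G\<close> yields
    the quadratic form \<open>q\<close> there, \<open>L e'\<close> being 0 at
    \<open>None\<close>.\<close>
  define G where "G k = (case k of Some i \<Rightarrow> P * Var (Some i) | None \<Rightarrow> - q)" for k
  define F where "F e' k = L e' k - G k" for e' k
  have homF: "homogeneous (d k) (F e' k)" for e' k
  proof (cases k)
    case None
    have "homogeneous 2 q"
      unfolding q_def by (intro homogeneous_diff homogeneous_sum homogeneous_Var_power)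
    then show ?thesis
      by (simp add: None F_def L_def G_def d_def)
  next
    case (Some i)
    have "m - 2 + 1 = m - 1"
      using T(2) by simp
    then have "homogeneous (m - 1) (P * Var (Some i))"
      unfolding P_def
      using homogeneous_mult[OF homogeneous_Const_mult[OF homogeneous_Var_power] homogeneous_Var] by metis
    then show ?thesis
      using homogeneous_diff[OF homogeneous_hm_apply[OF homogeneous_Var]]
      by (simp add: Some F_def L_def G_def d_def)
  qed
  fix i0 :: 'n
  have d: "even (d (Some i0))" "even (d None)" "\<And>k. d k > 0"
    using T(2,3) by (auto simp: d_def split: option.split)
  obtain H :: "'n option \<Rightarrow> ('n option, complex) mpoly"
    where H: "\<And>k. homogeneous (d k) (H k)" "\<not> has_zero H" "reflect (mat_one (Some i0)) H = H"
    using invariant_system_even[OF d(1,2) _ d(3)] by auto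
  have s_None: "?s None k = mat_one None k" "?s k None = mat_one k None" for k
    by (simp_all add: scale_along_def)
  have lin_None: "lin_form ?s None = Var None"
    using lin_form_mat_one[of "None :: 'n option", where 'c = complex] by (simp add: lin_form_def s_None)
  have subst_q: "subst_lin ?s q = q"
    using sum_squares_lin_form[OF wc_unit] by (simp add: q_def subst_simps sum_option lin_None)
  \<comment> \<open>Row \<open>None\<close> of the matrix is that of the identity, so this form only
    undergoes the change of variables.\<close>
  have None: "reflect ?wc K None = subst_lin ?s (K None)" for K
  proof -
    have "Const (?s None k) = (mat_one None k :: ('n option, complex) mpoly)" for k
      by (simp add: s_None) (simp add: mat_one_def Const_simps)
    then show ?thesis
      by (simp add: act_def)
  qed
  have "reflect ?wc G (Some i) = G (Some i)" for i
  proof -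
    have "reflect ?wc G (Some i) = P * Var (Some i)"
    proof (rule reflect_multiple_of_Var[OF wc_unit])
      fix k assume "?s (Some i) k \<noteq> 0"
      then obtain j where "k = Some j"
        by (cases k) (auto simp: s_None mat_one_def)
      then show "subst_lin ?s (G k) = P * lin_form ?s k"
        by (simp add: G_def P_def subst_simps lin_None)
    qed
    then show ?thesis
      by (simp add: G_def)
  qed
  moreover have "reflect ?wc (L e) (Some i) = L (reflect_frame u e) (Some i)" for i
    unfolding wc using reflect_hm_apply_option[OF T(1) _ e, of "L e"] T(2) by (simp add: L_def)
  moreover have LG_None: "L e' None = 0" "G None = - q" for e'
    by (simp_all add: L_def G_def)
  ultimately have "reflect ?wc (F e) k = F (reflect_frame u e) k" for k
    unfolding F_def[abs_def] act_diff
    by (cases k) (simp_all add: None LG_None subst_simps subst_q)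
  then have "reflect ?wc (F e) = F (reflect_frame u e)"
    by (rule ext)
  \<comment> \<open>As \<open>?w\<close> vanishes at \<open>None\<close>, all degrees on its support
    equal \<open>m - 1\<close>.\<close>
  moreover have "value_at R (reflect ?wc (F e)) = value_at R (F e)"
    by (rule value_reflect[OF R w_unit _ H homF]) (simp add: d_def split: option.splits)
  ultimately have "value_at R (F (reflect_frame u e)) = value_at R (F e)"
    by simp
  moreover have "(\<lambda>k. map_coeffs (\<lambda>p. poly p l) (E_forms_odd m (hypermatrix T e') k)) = F e'" for e' :: "'n \<Rightarrow> 'v"
    by (rule ext) (simp add: map_coeffs_E_forms_odd F_def L_def G_def P_def q_def split: option.split)
  ultimately show "value_at R (\<lambda>k. map_coeffs (\<lambda>p. poly p l) (E_forms_odd m (hypermatrix T (reflect_frame u e)) k)) =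
      value_at R (\<lambda>k. map_coeffs (\<lambda>p. poly p l) (E_forms_odd m (hypermatrix T e) k))"
    by simp
qed

lemma E_char_poly_reflect:
  fixes e :: "'n::finite \<Rightarrow> 'v::euclidean_space"
  assumes "complex_tensor m T" "m \<ge> 2" "orthonormal_frame e" "norm u = 1"
  shows "E_char_poly m (hypermatrix T (reflect_frame u e)) = E_char_poly m (hypermatrix T e)"
proof (cases "even m")
  case True
  show ?thesis
    unfolding E_char_poly_def if_P[OF True] by (rule E_forms_even_resultant_reflect[OF assms(1,2) True assms(3,4)])
next
  case False
  show ?thesis
    unfolding E_char_poly_def if_not_P[OF False] by (rule E_forms_odd_resultant_reflect[OF assms(1,2) False assms(3,4)])
qed

theorem theorem1:
  fixes T :: "'v::euclidean_space list \<Rightarrow> complex"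
    and m :: nat
  assumes "m \<ge> 2"
    and "CARD('n::finite) = DIM('v)"
    and "complex_tensor m T"
  shows "(even m \<or> DIM('v) \<ge> 2 \<longrightarrow>
            orthonormal_invariant (\<lambda>A :: 'n list \<Rightarrow> complex. hm_resultant m A) T) \<and>
         (\<forall>k. orthonormal_invariant (\<lambda>A :: 'n list \<Rightarrow> complex. coeff (E_char_poly m A) k) T)"
  unfolding orthonormal_invariant_def
proof (intro conjI impI allI)
  fix e e' :: "'n \<Rightarrow> 'v"
  assume e: "orthonormal_frame e" "orthonormal_frame e'"
  show "hm_resultant m (hypermatrix T e) = hm_resultant m (hypermatrix T e')" if "even m \<or> DIM('v) \<ge> 2"
    by (rule frame_reflection_invariant[where Q = "\<lambda>e. hm_resultant m (hypermatrix T e)", OF _ e])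
      (rule hm_resultant_reflect[OF assms(3,1)], use that assms(2) in auto)
  show "coeff (E_char_poly m (hypermatrix T e)) k = coeff (E_char_poly m (hypermatrix T e')) k" for k
    by (rule frame_reflection_invariant[where Q = "\<lambda>e. coeff (E_char_poly m (hypermatrix T e)) k", OF _ e])
      (simp add: E_char_poly_reflect[OF assms(3,1)])
qed

end
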